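(* Let $p,q\in[0,1]$, $\alpha=2p-1$, $\gamma>0$, let $\{X_k\}_{k\ge1}$ be the steps of the elephant random walk with parameters $p,q$, and let $S_n=\sum_{k=1}^n X_k k^{-\gamma}$. (i) Suppose $\alpha\in[-1,1/2]$. Then for every $\gamma\in(0,1/2]$ with $\gamma\neq\gamma_0(\alpha)$, $$P\Bigl(-\infty=\liminf_{n\to\infty}S_n<\limsup_{n\to\infty}S_n=+\infty\Bigr)=1,$$ where $\gamma_0(\alpha)=\max\{\alpha,\,-\alpha/(1-2\alpha)\}$ for $\alpha<1/2$ and $\gamma_0(1/2)=1/2$. On the other hand, $\{S_n\}$ converges (to a finite limit) with probability one for every $\gamma>1/2$. (ii) Suppose $\alpha\in(1/2,1]$. Then for every $\gamma\in(0,\alpha]$, $$P\Bigl(\lim_{n\to\infty}S_n=-\infty\ \text{ or }\ \lim_{n\to\infty}S_n=+\infty\Bigr)=1,$$ while $\{S_n\}$ converges (to a finite limit) with probability one for every $\gamma>\alpha$.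
   Context: Elephant random walk (ERW) steps: fix $p,q\in[0,1]$. The first step $X_1$ equals $+1$ with probability $q$ and $-1$ with probability $1-q$. For each $n\ge1$, $U_n$ is uniformly distributed on $\{1,\dots,n\}$, and $X_{n+1}=X_{U_n}$ with probability $p$ and $X_{n+1}=-X_{U_n}$ with probability $1-p$. The random variables $X_1$, $U_1,U_2,\dots$ and the coin tosses deciding the signs are all mutually independent. The memory parameter is $\alpha=2p-1\in[-1,1]$. The ERW with polynomially decaying steps with exponent $\gamma>0$ is $S_0=0$, $S_n=\sum_{k=1}^n X_k k^{-\gamma}$ for $n\ge 1$. *)

theory Defs
  imports "HOL-Probability.Probability"
begin

text \<open>Index type of the independent sources of randomness: the first step, the memory variables
  \<open>U n\<close> and the coin tosses \<open>C n\<close>.\<close>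

datatype erw_source = First | Memory nat | Coin nat

text \<open>
  \<open>C n\<close> is the event that the remembered step \<open>X (U n)\<close> is repeated rather than reversed.
  Since \<open>indep_vars\<close> needs a common codomain, the natural-valued and Boolean
  variables are embedded injectively into the reals; this does not change the sigma-algebras they
  generate. The values of \<open>X\<close> at \<open>0\<close> and of \<open>U\<close>, \<open>C\<close> at \<open>0\<close> are irrelevant.
\<close>

locale elephant_random_walk = prob_space M for M :: "'a measure" +
  fixes p q :: real
    and X :: "nat \<Rightarrow> 'a \<Rightarrow> real"
    and U :: "nat \<Rightarrow> 'a \<Rightarrow> nat"
    and C :: "nat \<Rightarrow> 'a \<Rightarrow> bool"
  assumes indep_sources:
      "indep_vars (\<lambda>_. borel)
         (\<lambda>s. case s of
                First \<Rightarrow> X 1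
              | Memory n \<Rightarrow> (\<lambda>\<omega>. real (U n \<omega>))
              | Coin n \<Rightarrow> (\<lambda>\<omega>. of_bool (C n \<omega>)))
         ({First} \<union> Memory ` {1..} \<union> Coin ` {1..})"
    and first_step_pos: "\<P>(\<omega> in M. X 1 \<omega> = 1) = q"
    and first_step_neg: "\<P>(\<omega> in M. X 1 \<omega> = -1) = 1 - q"
    and memory_uniform: "\<And>n k. 1 \<le> k \<Longrightarrow> k \<le> n \<Longrightarrow> \<P>(\<omega> in M. U n \<omega> = k) = 1 / real n"
    and coin: "\<And>n. 1 \<le> n \<Longrightarrow> \<P>(\<omega> in M. C n \<omega>) = p"
    and step: "\<And>n \<omega>. 1 \<le> n \<Longrightarrow> \<omega> \<in> space M \<Longrightarrow>
      X (Suc n) \<omega> = (if C n \<omega> then X (U n \<omega>) \<omega> else - X (U n \<omega>) \<omega>)"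

definition erw_poly_sum :: "(nat \<Rightarrow> 'a \<Rightarrow> real) \<Rightarrow> real \<Rightarrow> nat \<Rightarrow> 'a \<Rightarrow> real" where
  "erw_poly_sum X \<gamma> n \<omega> = (\<Sum>k=1..n. X k \<omega> * real k powr (- \<gamma>))"

text \<open>Only used for \<open>\<alpha> \<le> 1/2\<close>.\<close>

definition gamma0 :: "real \<Rightarrow> real" where
  "gamma0 \<alpha> = (if \<alpha> < 1/2 then max \<alpha> (- \<alpha> / (1 - 2 * \<alpha>)) else 1/2)"

end

theory Submission
  imports Defs
begin

text \<open>
  Let \<open>T n\<close> be the sum of the first \<open>n\<close> steps and \<open>\<xi> k = X (k + 1) - \<alpha> T k / k\<close> the martingale
  differences. Sums \<open>W\<close> of \<open>w k \<xi> k\<close> have, conditionally on any event determined by the past,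
  second moment comparable to \<open>V = \<Sum> (w k)\<^sup>2\<close> and fourth moment at most \<open>64 V\<^sup>2\<close>, so that
  \<open>W \<ge> \<epsilon> sqrt V\<close> has conditional probability at least \<open>c\<close>, with constants depending
  only on \<open>\<alpha>\<close> (Paley--Zygmund); the exception is \<open>\<alpha> = 1\<close>, where \<open>T n = \<plusminus> n\<close>.

  For \<open>\<alpha> \<le> 1/2\<close> and \<open>\<gamma> \<le> 1/2\<close>, decompose \<open>S n\<close> as \<open>S m + h T m + W\<close>, where \<open>h T m\<close> is the mean
  of \<open>S n - S m\<close> given the first \<open>m\<close> steps. As \<open>n\<close> grows, \<open>V\<close> dominates \<open>(1 + \<bar>h\<bar>)\<^sup>2\<close>; hence, whatever
  happened up to time \<open>m\<close>, the walk exceeds any level with probability at least \<open>c\<close> later on, and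
  therefore almost surely.

  For \<open>\<gamma> > max \<alpha> (1/2)\<close>, the martingale part of \<open>S n\<close> converges by Kolmogorov's maximal inequality and
  the drift part converges absolutely, since \<open>E (T k)\<^sup>2\<close> is at most of order \<open>k powr (2 \<beta>)\<close> with \<open>\<beta> < \<gamma>\<close>.

  For \<open>\<alpha> > 1/2\<close>, normalising \<open>T n\<close> by the product of the factors \<open>1 + \<alpha> / k\<close> yields a convergent
  martingale. Its limit is almost surely nonzero, again by the uniform lower bound, so \<open>T n\<close>
  is eventually of order at least \<open>n powr \<alpha>\<close> with a fixed sign, and summation by parts gives the
  divergence for \<open>\<gamma> \<le> \<alpha>\<close>.
\<close>

section \<open>Processes determined by their past\<close>

text \<open>Stands in for measurability with respect to the sigma-algebra of the first n steps. The
  codomain is arbitrary, so that events and real variables are treated alike; measurability of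
  \<open>Z\<close> follows once the steps are measurable with finitely many values.\<close>

definition determined_by :: "(nat \<Rightarrow> 'a \<Rightarrow> real) \<Rightarrow> nat \<Rightarrow> ('a \<Rightarrow> 'b) \<Rightarrow> bool" where
  "determined_by Y n Z \<longleftrightarrow> (\<forall>\<omega> \<omega>'. (\<forall>k\<in>{1..n}. Y k \<omega> = Y k \<omega>') \<longrightarrow> Z \<omega> = Z \<omega>')"

lemma determined_by_const: "determined_by Y n (\<lambda>_. c)"
  by (simp add: determined_by_def)

lemma determined_by_step: "1 \<le> k \<Longrightarrow> k \<le> n \<Longrightarrow> determined_by Y n (Y k)"
  by (simp add: determined_by_def)

lemma determined_by_mono: "determined_by Y m Z \<Longrightarrow> m \<le> n \<Longrightarrow> determined_by Y n Z"
  unfolding determined_by_def by (metis atLeastAtMost_iff order_trans)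

lemma determined_by_map: "determined_by Y n f \<Longrightarrow> determined_by Y n (\<lambda>\<omega>. F (f \<omega>))"
  unfolding determined_by_def by metis

lemma determined_by_map2:
  "determined_by Y n f \<Longrightarrow> determined_by Y n g \<Longrightarrow> determined_by Y n (\<lambda>\<omega>. F (f \<omega>) (g \<omega>))"
  unfolding determined_by_def by metis

lemma determined_by_sum:
  "(\<And>k. k \<in> A \<Longrightarrow> determined_by Y n (f k)) \<Longrightarrow> determined_by Y n (\<lambda>\<omega>. \<Sum>k\<in>A. f k \<omega>)"
  unfolding determined_by_def by (intro allI impI sum.cong) (metis+)

lemma determined_by_Bex:
  "(\<And>k. k \<in> A \<Longrightarrow> determined_by Y n (f k)) \<Longrightarrow> determined_by Y n (\<lambda>\<omega>. \<exists>k\<in>A. f k \<omega>)"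
  unfolding determined_by_def by metis

lemma determined_by_Ball:
  "(\<And>k. k \<in> A \<Longrightarrow> determined_by Y n (f k)) \<Longrightarrow> determined_by Y n (\<lambda>\<omega>. \<forall>k\<in>A. f k \<omega>)"
  unfolding determined_by_def by metis

text \<open>A set-theoretic Doob-Dynkin lemma: \<open>\<phi>\<close> evaluates \<open>Z\<close> at
  an arbitrarily chosen point with the given history. It reduces measurability and boundedness of
  \<open>Z\<close> to facts about lists of signs.\<close>

lemma determined_by_factor:
  assumes "determined_by Y n Z"
  obtains \<phi> where "\<And>\<omega>. Z \<omega> = \<phi> (map (\<lambda>k. Y k \<omega>) [1..<Suc n])"
proof
  let ?H = "\<lambda>\<omega>. map (\<lambda>k. Y k \<omega>) [1..<Suc n]"
  fix \<omega>
  define \<omega>' where "\<omega>' = (SOME \<omega>'. ?H \<omega>' = ?H \<omega>)"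
  have "?H \<omega>' = ?H \<omega>"
    unfolding \<omega>'_def by (rule someI[of "\<lambda>\<omega>'. ?H \<omega>' = ?H \<omega>" \<omega>]) simp
  then have "\<forall>k\<in>{1..n}. Y k \<omega>' = Y k \<omega>"
    unfolding map_eq_conv by auto
  then show "Z \<omega> = (\<lambda>l. Z (SOME \<omega>'. ?H \<omega>' = l)) (?H \<omega>)"
    using assms unfolding determined_by_def \<omega>'_def by metis
qed

text \<open>A quartic lies below a multiple of an indicator. Integrated for a variable with mean 0,
  second moment at least \<delta> and fourth moment at most 64, it yields K P(\<epsilon> \<le> x)
  \<ge> s \<delta> - 64 t - d > 0. The linear term vanishes on average and makes the bound
  one-sided.\<close>

lemma paley_zygmund_polynomial:
  fixes \<delta> :: real
  assumes "0 < \<delta>" "\<delta> \<le> 1"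
  obtains s t d \<epsilon> K where "0 \<le> s" "0 \<le> t" "0 < \<epsilon>" "0 < K" "0 < s * \<delta> - 64 * t - d"
    and "\<And>x. x + s * x^2 - t * x^4 - d \<le> K * of_bool (\<epsilon> \<le> x)"
proof -
  \<comment> \<open>The choice of s and t gives x + s x^2 - t x^4 a double root at -1/u, so that it
    is nonpositive for x \<le> 0. The size of u makes 64 t at most u \<delta> / 2, against s
    \<delta> = 3 u \<delta> / 2 and d = u \<delta> / 2.\<close>
  define u where "u = \<delta> / 8"
  define s where "s = 3/2 * u"
  define t where "t = u^3 / 2"
  define d where "d = u * \<delta> / 2"
  define \<epsilon> where "\<epsilon> = d / 4"
  define K where "K = 1/2 + (1/2 + s)^2 / (4 * t)"
  have u: "0 < u" "u \<le> 1/8" using assms by (auto simp: u_def)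
  have "u * \<delta> \<le> 1/8 * 1" using u assms by (intro mult_mono) simp_all
  moreover have "0 < u * \<delta>" using u assms by simp
  ultimately have pos: "0 < s" "0 < t" "0 < d" "0 < \<epsilon>" "s \<le> 1" "d \<le> 1/16"
    using u by (simp_all add: s_def t_def d_def \<epsilon>_def mult.commute)
  have K: "0 < K" using pos unfolding K_def by (intro add_pos_nonneg) simp_all
  have "64 * t \<le> u * \<delta> / 2"
  proof -
    have "64 * t = u * \<delta> * \<delta> / 2" by (simp add: t_def u_def power3_eq_cube)
    also have "\<dots> \<le> u * \<delta> / 2" using assms u by (simp add: mult_left_le)
    finally show ?thesis .
  qed
  moreover have "s * \<delta> = 3/2 * (u * \<delta>)" by (simp add: s_def)
  ultimately have gap: "0 < s * \<delta> - 64 * t - d" using \<open>0 < u * \<delta>\<close> unfolding d_def by linarith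
  have "x + s * x^2 - t * x^4 - d \<le> K * of_bool (\<epsilon> \<le> x)" for x
  proof -
    consider "x \<le> 0" | "0 < x" "x < \<epsilon>" | "\<epsilon> \<le> x" by linarith
    then show ?thesis
    proof cases
      case 1
      have "x + s * x^2 - t * x^4 = x * ((u * (-x) - 1)^2 * (u * (-x) + 2)) / 2"
        unfolding s_def t_def by (simp add: power2_eq_square power3_eq_cube power4_eq_xxxx algebra_simps)
      also have "\<dots> \<le> 0"
      proof -
        have "u * x \<le> 0" using 1 u by (simp add: mult_nonneg_nonpos)
        then have "x * ((u * (-x) - 1)^2 * (u * (-x) + 2)) \<le> 0"
          using 1 by (intro mult_nonpos_nonneg mult_nonneg_nonneg) simp_all
        then show ?thesis by simp
      qed
      finally have "x + s * x^2 - t * x^4 \<le> 0" .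
      then show ?thesis using pos K 1 by auto
    next
      case 2
      have "s * x^2 \<le> 1 * (x * 1)"
        unfolding power2_eq_square using 2 pos by (intro mult_mono) (auto simp: \<epsilon>_def)
      then have "x + s * x^2 \<le> 2 * \<epsilon>" using 2 by simp
      moreover have "0 \<le> t * x^4" using pos by simp
      ultimately have "x + s * x^2 - t * x^4 - d \<le> 0" using pos(3) unfolding \<epsilon>_def by linarith
      then show ?thesis using 2 by simp
    next
      case 3
      \<comment> \<open>For large x the linear term is absorbed into x^2 and the square is completed
        in the variable x^2; K is the resulting maximum.\<close>
      have "x \<le> 1/2 + 1/2 * x^2" using sum_squares_bound[of x 1] by simp
      then have "x + s * x^2 - t * x^4 \<le> 1/2 + ((1/2 + s) * x^2 - t * x^4)"
        by (simp add: algebra_simps)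
      also have "\<dots> = K - t * (x^2 - (1/2 + s) / (2 * t))^2"
      proof -
        have "A * y - t * y^2 = A^2 / (4 * t) - t * (y - A / (2 * t))^2" for A y
          using pos(2) by (simp add: power2_diff field_simps) (simp add: power2_eq_square)
        from this[of "1/2 + s" "x^2"] show ?thesis by (simp add: K_def)
      qed
      also have "\<dots> \<le> K" using pos by simp
      finally show ?thesis using 3 pos by simp
    qed
  qed
  with that[of s t \<epsilon> K d] pos K gap show thesis by simp
qed

text \<open>There are only finitely many histories, so every function of the history is measurable,
  whatever \<open>\<phi>\<close> is, even into a discrete space.\<close>

lemma history_measurable:
  assumes meas: "\<And>k. 1 \<le> k \<Longrightarrow> k \<le> n \<Longrightarrow> Y k \<in> borel_measurable N"
    and vals: "\<And>k \<omega>. Y k \<omega> = 1 \<or> Y k \<omega> = (-1 :: real)"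
  shows "(\<lambda>\<omega>. \<phi> (map (\<lambda>k. Y k \<omega>) [1..<Suc n])) \<in> measurable N (count_space UNIV)"
proof -
  define H where "H = (\<lambda>\<omega>. map (\<lambda>k. Y k \<omega>) [1..<Suc n])"
  let ?L = "{l. set l \<subseteq> {1, -1::real} \<and> length l = n}"
  have "H \<in> measurable N (count_space ?L)"
  proof (subst measurable_count_space_eq2)
    show "finite ?L" by (rule finite_lists_length_eq) simp
    have "H -` {l} \<inter> space N \<in> sets N" if "l \<in> ?L" for l
    proof -
      have "length l = n" using that by simp
      then have "H \<omega> = l \<longleftrightarrow> (\<forall>i<n. Y (Suc i) \<omega> = l ! i)" for \<omega>
        unfolding H_def list_eq_iff_nth_eq by (simp del: upt_Suc)
      then have "H -` {l} \<inter> space N = {\<omega>\<in>space N. \<forall>i<n. Y (Suc i) \<omega> = l ! i}"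
        by blast
      moreover have [measurable]: "Y (Suc i) \<in> borel_measurable N" if "i < n" for i
        using meas[of "Suc i"] that by simp
      ultimately show ?thesis by simp
    qed
    moreover have "H \<in> space N \<rightarrow> ?L"
      using vals unfolding H_def by (intro funcsetI) (auto simp del: upt_Suc)
    ultimately show "H \<in> space N \<rightarrow> ?L \<and> (\<forall>a\<in>?L. H -` {a} \<inter> space N \<in> sets N)"
      by blast
  qed
  moreover have "\<phi> \<in> measurable (count_space ?L) (count_space UNIV)" by simp
  ultimately show ?thesis unfolding H_def by (rule measurable_compose)
qed

text \<open>The last assumption is the tested form of E[Y (n+1) | past] = \<alpha> T n / n, from
  which the limit behaviour is derived. The values are 1 or -1 at every point, not merely almost
  surely, so that the histories form a finite set.\<close>

locale step_process = prob_space M for M :: "'a measure" +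
  fixes \<alpha> :: real and Y :: "nat \<Rightarrow> 'a \<Rightarrow> real"
  assumes alpha_bounds: "-1 \<le> \<alpha>" "\<alpha> \<le> 1"
    and step_measurable [measurable]: "\<And>k. Y k \<in> borel_measurable M"
    and step_values: "\<And>k \<omega>. Y k \<omega> = 1 \<or> Y k \<omega> = -1"
    and regression: "\<And>n Z. 1 \<le> n \<Longrightarrow> determined_by Y n Z \<Longrightarrow>
      expectation (\<lambda>\<omega>. Z \<omega> * Y (Suc n) \<omega>) = \<alpha> / n * expectation (\<lambda>\<omega>. Z \<omega> * (\<Sum>k=1..n. Y k \<omega>))"
begin

abbreviation "adapted \<equiv> determined_by Y"

definition T :: "nat \<Rightarrow> 'a \<Rightarrow> real" where "T n \<omega> = (\<Sum>k=1..n. Y k \<omega>)"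

definition \<xi> :: "nat \<Rightarrow> 'a \<Rightarrow> real" where "\<xi> n \<omega> = Y (Suc n) \<omega> - \<alpha> * T n \<omega> / n"

lemma abs_step [simp]: "\<bar>Y k \<omega>\<bar> = 1"
  using step_values[of k \<omega>] by auto

lemma T_Suc: "T (Suc n) \<omega> = T n \<omega> + Y (Suc n) \<omega>"
  by (simp add: T_def)

lemma abs_T_le: "\<bar>T n \<omega>\<bar> \<le> n"
  unfolding T_def using sum_abs[of "\<lambda>k. Y k \<omega>" "{1..n}"] by simp

lemma abs_drift_le: "\<bar>\<alpha> * T n \<omega> / n\<bar> \<le> \<bar>\<alpha>\<bar>"
  using abs_T_le[of n \<omega>] by (cases "n = 0") (auto simp: abs_mult divide_le_eq mult_left_mono)

lemma abs_noise_le: "\<bar>\<xi> n \<omega>\<bar> \<le> 2"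
  using abs_drift_le[of n \<omega>] alpha_bounds abs_triangle_ineq4[of "Y (Suc n) \<omega>" "\<alpha> * T n \<omega> / n"]
  unfolding \<xi>_def by (simp del: abs_divide abs_mult)

lemma determined_T: "n \<le> m \<Longrightarrow> adapted m (T n)"
  unfolding T_def[abs_def] by (intro determined_by_sum determined_by_step) auto

lemma determined_noise: "n < m \<Longrightarrow> adapted m (\<xi> n)"
  unfolding \<xi>_def[abs_def]
  by (intro determined_by_map2[where F = "(-)"] determined_by_map[where F = "\<lambda>x. \<alpha> * x / n"]
      determined_by_step determined_T) auto

lemma determined_measurable:
  assumes "adapted n Z"
  shows "Z \<in> measurable M (count_space UNIV)"
proof -
  obtain \<phi> where \<phi>: "\<And>\<omega>. Z \<omega> = \<phi> (map (\<lambda>k. Y k \<omega>) [1..<Suc n])"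
    using determined_by_factor[OF assms] by blast
  have "Z = (\<lambda>\<omega>. \<phi> (map (\<lambda>k. Y k \<omega>) [1..<Suc n]))" by (rule ext) (rule \<phi>)
  then show ?thesis using history_measurable[of n Y M \<phi>] step_values by simp
qed

lemma determined_borel [intro]: "adapted n Z \<Longrightarrow> Z \<in> borel_measurable M"
  for Z :: "'a \<Rightarrow> real"
  using measurable_compose[OF determined_measurable, of n Z id borel] by simp

lemma determined_event [intro]: "adapted n P \<Longrightarrow> {\<omega>\<in>space M. P \<omega>} \<in> events"
  using determined_measurable[of n P] by simp

lemma determined_integrable:
  fixes Z :: "'a \<Rightarrow> real"
  assumes "adapted n Z"
  shows "integrable M Z"
proof -
  obtain \<phi> where \<phi>: "\<And>\<omega>. Z \<omega> = \<phi> (map (\<lambda>k. Y k \<omega>) [1..<Suc n])"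
    using determined_by_factor[OF assms] by blast
  let ?L = "{l. set l \<subseteq> {1, -1::real} \<and> length l = n}"
  have fin: "finite ?L" by (rule finite_lists_length_eq) simp
  have "map (\<lambda>k. Y k \<omega>) [1..<Suc n] \<in> ?L" for \<omega>
    using step_values by (auto simp del: upt_Suc)
  then have "norm (Z \<omega>) \<le> Max ((\<lambda>l. \<bar>\<phi> l\<bar>) ` ?L)" for \<omega>
    using fin by (subst \<phi>) (intro Max_ge, simp, simp only: real_norm_def, blast)
  then show ?thesis
    by (intro integrable_const_bound[where B = "Max ((\<lambda>l. \<bar>\<phi> l\<bar>) ` ?L)"]) (use assms in auto)
qed

lemma expectation_mult_step:
  assumes "1 \<le> n" "adapted n Z"
  shows "expectation (\<lambda>\<omega>. Z \<omega> * Y (Suc n) \<omega>) = \<alpha> / n * expectation (\<lambda>\<omega>. Z \<omega> * T n \<omega>)"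
  using regression[OF assms] by (simp add: T_def)

lemma expectation_mult_noise:
  assumes "1 \<le> n" "adapted n Z"
  shows "expectation (\<lambda>\<omega>. Z \<omega> * \<xi> n \<omega>) = 0"
proof -
  have "integrable M (\<lambda>\<omega>. Z \<omega> * Y (Suc n) \<omega>)" "integrable M (\<lambda>\<omega>. \<alpha> / n * (Z \<omega> * T n \<omega>))"
    by (intro determined_integrable[of "Suc n"] determined_by_map[where F = "\<lambda>x. \<alpha> / n * x"]
        determined_by_map2[where F = "(*)"] determined_by_mono[OF assms(2)] determined_by_step
        determined_T; simp)+
  then have "expectation (\<lambda>\<omega>. Z \<omega> * Y (Suc n) \<omega> - \<alpha> / n * (Z \<omega> * T n \<omega>)) = 0"
    using expectation_mult_step[OF assms] by simp
  then show ?thesis by (simp add: \<xi>_def algebra_simps)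
qed

end

section \<open>Moments of martingale transforms\<close>

lemma (in prob_space) expectation_of_bool:
  assumes "{\<omega>\<in>space M. P \<omega>} \<in> events"
  shows "expectation (\<lambda>\<omega>. of_bool (P \<omega>) :: real) = \<P>(\<omega> in M. P \<omega>)"
proof -
  have "expectation (\<lambda>\<omega>. of_bool (P \<omega>) :: real) = expectation (indicator {\<omega>\<in>space M. P \<omega>})"
    by (intro Bochner_Integration.integral_cong) (auto simp: indicator_def)
  then show ?thesis using assms by simp
qed

section \<open>Moments and one-sided lower tails of weighted noise sums\<close>

context step_process begin

abbreviation transform :: "(nat \<Rightarrow> 'a \<Rightarrow> real) \<Rightarrow> nat \<Rightarrow> nat \<Rightarrow> 'a \<Rightarrow> real" where
  "transform w m n \<omega> \<equiv> (\<Sum>k=m..<n. w k \<omega> * \<xi> k \<omega>)"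

lemma determined_transform:
  assumes "\<And>k. m \<le> k \<Longrightarrow> adapted k (w k)"
  shows "adapted n (transform w m n)"
  by (intro determined_by_sum determined_by_map2[where F = "(*)"] determined_noise)
     (auto intro: determined_by_mono[OF assms])

lemma noise_power2_le: "(\<xi> k \<omega>)^2 \<le> 4"
  using power_mono[OF abs_noise_le[of k \<omega>], of 2] by simp

lemmas adapted_binop = determined_by_map2[where F = "(*)"] determined_by_map2[where F = "(+)"]
  determined_by_map2[where F = "(-)"]

lemmas adapted_intros = adapted_binop determined_by_map[where F = "\<lambda>x. x ^ (j :: nat)" for j]
  determined_by_const

lemma transform_second_moment:
  assumes "1 \<le> m" "adapted m Z" "\<And>\<omega>. 0 \<le> Z \<omega>"
    and w: "\<And>k. m \<le> k \<Longrightarrow> adapted k (w k)" "\<And>k \<omega>. m \<le> k \<Longrightarrow> \<bar>w k \<omega>\<bar> \<le> c k"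
  shows "expectation (\<lambda>\<omega>. Z \<omega> * (transform w m n \<omega>)^2) \<le> 4 * (\<Sum>k=m..<n. (c k)^2) * expectation Z"
proof (induction n)
  case (Suc n)
  show ?case
  proof (cases "m \<le> n")
    case True
    let ?W = "transform w m n"
    have Z: "adapted n Z" and W: "adapted n ?W" and wn: "adapted n (w n)"
      using determined_by_mono[OF assms(2) True] determined_transform[of m w n] w True by auto
    have int: "integrable M (\<lambda>\<omega>. Z \<omega> * (?W \<omega>)^2)" "integrable M Z"
      "integrable M (\<lambda>\<omega>. (2 * Z \<omega> * ?W \<omega> * w n \<omega>) * \<xi> n \<omega>)"
      "integrable M (\<lambda>\<omega>. Z \<omega> * (transform w m (Suc n) \<omega>)^2)"
      by (intro determined_integrable[of "Suc n"] adapted_intros determined_noise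
          determined_by_mono[OF Z] determined_by_mono[OF W] determined_by_mono[OF wn]
          determined_transform w order.refl le_SucI; simp)+
    have cross: "expectation (\<lambda>\<omega>. (2 * Z \<omega> * ?W \<omega> * w n \<omega>) * \<xi> n \<omega>) = 0"
      using True assms(1) by (intro expectation_mult_noise adapted_intros Z W wn) simp
    have "Z \<omega> * (transform w m (Suc n) \<omega>)^2
       \<le> Z \<omega> * (?W \<omega>)^2 + (2 * Z \<omega> * ?W \<omega> * w n \<omega>) * \<xi> n \<omega> + 4 * (c n)^2 * Z \<omega>" for \<omega>
    proof -
      have "(w n \<omega>)^2 * (\<xi> n \<omega>)^2 \<le> (c n)^2 * 4"
        using power_mono[OF w(2)[OF True, of \<omega>], of 2] noise_power2_le[of n \<omega>]
        by (intro mult_mono) auto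
      from mult_left_mono[OF this assms(3)[of \<omega>]] True show ?thesis
        by (simp add: power2_eq_square algebra_simps)
    qed
    then have "expectation (\<lambda>\<omega>. Z \<omega> * (transform w m (Suc n) \<omega>)^2)
       \<le> expectation (\<lambda>\<omega>. Z \<omega> * (?W \<omega>)^2 + (2 * Z \<omega> * ?W \<omega> * w n \<omega>) * \<xi> n \<omega> + 4 * (c n)^2 * Z \<omega>)"
      using int by (intro integral_mono) auto
    also have "\<dots> = expectation (\<lambda>\<omega>. Z \<omega> * (?W \<omega>)^2) + 4 * (c n)^2 * expectation Z"
      using int cross by simp
    finally show ?thesis using Suc True by (simp add: algebra_simps)
  qed simp
qed simp

text \<open>Induction again, the term linear in the new increment having mean 0. The constant 64
  closes the induction: the second moment contributes 32 times 4 = 128 times (c n)^2 V, the mixed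
  term of 64 (V + (c n)^2)^2, and 48 \<le> 64.\<close>

lemma transform_fourth_moment:
  assumes "1 \<le> m" "adapted m Z" "\<And>\<omega>. 0 \<le> Z \<omega>"
    and w: "\<And>k. m \<le> k \<Longrightarrow> adapted k (w k)" "\<And>k \<omega>. m \<le> k \<Longrightarrow> \<bar>w k \<omega>\<bar> \<le> c k"
  shows "expectation (\<lambda>\<omega>. Z \<omega> * (transform w m n \<omega>)^4) \<le> 64 * (\<Sum>k=m..<n. (c k)^2)^2 * expectation Z"
proof (induction n)
  case (Suc n)
  show ?case
  proof (cases "m \<le> n")
    case True
    let ?W = "transform w m n"
    let ?V = "\<Sum>k=m..<n. (c k)^2"
    have Z: "adapted n Z" and W: "adapted n ?W" and wn: "adapted n (w n)"
      using determined_by_mono[OF assms(2) True] determined_transform[of m w n] w True by auto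
    have int: "integrable M (\<lambda>\<omega>. Z \<omega> * (?W \<omega>)^4)" "integrable M (\<lambda>\<omega>. Z \<omega> * (?W \<omega>)^2)" "integrable M Z"
      "integrable M (\<lambda>\<omega>. (4 * Z \<omega> * (?W \<omega>)^3 * w n \<omega>) * \<xi> n \<omega>)"
      "integrable M (\<lambda>\<omega>. Z \<omega> * (transform w m (Suc n) \<omega>)^4)"
      by (intro determined_integrable[of "Suc n"] adapted_intros determined_noise
          determined_by_mono[OF Z] determined_by_mono[OF W] determined_by_mono[OF wn]
          determined_transform w order.refl le_SucI; simp)+
    have cross: "expectation (\<lambda>\<omega>. (4 * Z \<omega> * (?W \<omega>)^3 * w n \<omega>) * \<xi> n \<omega>) = 0"
      using True assms(1) by (intro expectation_mult_noise adapted_intros Z W wn) simp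
    have "Z \<omega> * (transform w m (Suc n) \<omega>)^4
       \<le> Z \<omega> * (?W \<omega>)^4 + (4 * Z \<omega> * (?W \<omega>)^3 * w n \<omega>) * \<xi> n \<omega>
         + (32 * (c n)^2 * (Z \<omega> * (?W \<omega>)^2) + 48 * (c n)^4 * Z \<omega>)" for \<omega>
    proof -
      define x where "x = ?W \<omega>"
      define y where "y = w n \<omega> * \<xi> n \<omega>"
      have y: "y^2 \<le> (c n)^2 * 4"
        unfolding y_def power_mult_distrib
        using power_mono[OF w(2)[OF True, of \<omega>], of 2] noise_power2_le[of n \<omega>]
        by (intro mult_mono) auto
      have y4: "y^4 \<le> 16 * (c n)^4"
        using power_mono[OF y, of 2] by (simp add: power_mult_distrib flip: power_mult)
      \<comment> \<open>The term 4 x y^3 is neither of mean zero nor of known sign; adding the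
        nonnegative 2 y^2 (x - y)^2 cancels it at the cost of larger coefficients for x^2 y^2 and
        y^4.\<close>
      have "(x + y)^4 + 2 * y^2 * (x - y)^2 = x^4 + 4 * x^3 * y + 8 * (x^2 * y^2) + 3 * y^4"
        by algebra
      moreover have "0 \<le> 2 * y^2 * (x - y)^2" by simp
      ultimately have "(x + y)^4 \<le> x^4 + 4 * x^3 * y + 8 * (x^2 * y^2) + 3 * y^4" by linarith
      also have "\<dots> \<le> x^4 + 4 * x^3 * y + 8 * (x^2 * ((c n)^2 * 4)) + 3 * (16 * (c n)^4)"
        using mult_left_mono[OF y, of "x^2"] y4 by simp
      finally have "(x + y)^4 \<le> x^4 + 4 * x^3 * y + 32 * (c n)^2 * x^2 + 48 * (c n)^4" by (simp add: mult.commute)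
      from mult_left_mono[OF this assms(3)[of \<omega>]] True show ?thesis
        unfolding x_def y_def by (simp add: algebra_simps)
    qed
    then have "expectation (\<lambda>\<omega>. Z \<omega> * (transform w m (Suc n) \<omega>)^4)
       \<le> expectation (\<lambda>\<omega>. Z \<omega> * (?W \<omega>)^4 + (4 * Z \<omega> * (?W \<omega>)^3 * w n \<omega>) * \<xi> n \<omega>
         + (32 * (c n)^2 * (Z \<omega> * (?W \<omega>)^2) + 48 * (c n)^4 * Z \<omega>))"
      using int by (intro integral_mono) auto
    also have "\<dots> = expectation (\<lambda>\<omega>. Z \<omega> * (?W \<omega>)^4)
        + (32 * (c n)^2 * expectation (\<lambda>\<omega>. Z \<omega> * (?W \<omega>)^2) + 48 * (c n)^4 * expectation Z)"
      using int cross by simp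
    also have "\<dots> \<le> 64 * ?V^2 * expectation Z
        + (32 * (c n)^2 * (4 * ?V * expectation Z) + 48 * (c n)^4 * expectation Z)"
      using Suc transform_second_moment[OF assms(1-3) w, of n]
      by (intro add_mono mult_left_mono) auto
    also have "\<dots> \<le> 64 * (?V + (c n)^2)^2 * expectation Z"
    proof -
      have "0 \<le> expectation Z" using assms(3) by (simp add: integral_nonneg)
      then have "(64 * ?V^2 + 128 * (c n)^2 * ?V + 48 * (c n)^4) * expectation Z
          \<le> (64 * (?V + (c n)^2)^2) * expectation Z"
        by (intro mult_right_mono) (simp_all add: power2_sum flip: power_mult)
      then show ?thesis by (simp add: algebra_simps)
    qed
    finally show ?thesis using True by simp
  qed simp
qed simp

lemma transform_first_moment:
  assumes "1 \<le> m" "adapted m Z" and w: "\<And>k. m \<le> k \<Longrightarrow> adapted k (w k)"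
  shows "expectation (\<lambda>\<omega>. Z \<omega> * transform w m n \<omega>) = 0"
proof -
  have Z: "adapted k Z" if "k \<in> {m..<n}" for k
    using determined_by_mono[OF assms(2)] that by simp
  have "integrable M (\<lambda>\<omega>. Z \<omega> * w k \<omega> * \<xi> k \<omega>)" if "k \<in> {m..<n}" for k
    using that by (intro determined_integrable[of "Suc k"] adapted_intros determined_noise
        determined_by_mono[OF Z] determined_by_mono[OF w]) auto
  moreover have "expectation (\<lambda>\<omega>. Z \<omega> * w k \<omega> * \<xi> k \<omega>) = 0" if "k \<in> {m..<n}" for k
    using that assms(1) by (intro expectation_mult_noise adapted_intros Z w) auto
  ultimately have "expectation (\<lambda>\<omega>. \<Sum>k=m..<n. Z \<omega> * w k \<omega> * \<xi> k \<omega>) = 0"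
    by (subst Bochner_Integration.integral_sum) auto
  then show ?thesis by (simp add: sum_distrib_left mult.assoc)
qed

text \<open>For deterministic weights the increments are orthogonal under \<open>Z\<close>, so lower
  bounds on the individual noise variances add up.\<close>

lemma transform_second_moment_ge:
  assumes "1 \<le> m" "adapted m Z"
    and ge: "\<And>k. m \<le> k \<Longrightarrow> \<delta> * expectation Z \<le> expectation (\<lambda>\<omega>. Z \<omega> * (\<xi> k \<omega>)^2)"
  shows "\<delta> * (\<Sum>k=m..<n. (w k)^2) * expectation Z \<le> expectation (\<lambda>\<omega>. Z \<omega> * (transform (\<lambda>k _. w k) m n \<omega>)^2)"
proof (induction n)
  case (Suc n)
  show ?case
  proof (cases "m \<le> n")
    case True
    let ?W = "transform (\<lambda>k _. w k) m n"
    have Z: "adapted n Z" by (rule determined_by_mono[OF assms(2) True])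
    have W: "adapted n ?W" by (intro determined_transform determined_by_const)
    have int: "integrable M (\<lambda>\<omega>. Z \<omega> * (?W \<omega>)^2)" "integrable M (\<lambda>\<omega>. Z \<omega> * (\<xi> n \<omega>)^2)"
      "integrable M (\<lambda>\<omega>. (2 * w n * Z \<omega> * ?W \<omega>) * \<xi> n \<omega>)"
      by (intro determined_integrable[of "Suc n"] adapted_intros determined_noise
          determined_by_mono[OF Z] determined_by_mono[OF W]; simp)+
    have cross: "expectation (\<lambda>\<omega>. (2 * w n * Z \<omega> * ?W \<omega>) * \<xi> n \<omega>) = 0"
      using True assms(1) by (intro expectation_mult_noise adapted_intros Z W) simp
    have "\<delta> * (\<Sum>k=m..<Suc n. (w k)^2) * expectation Z
        \<le> expectation (\<lambda>\<omega>. Z \<omega> * (?W \<omega>)^2) + (w n)^2 * expectation (\<lambda>\<omega>. Z \<omega> * (\<xi> n \<omega>)^2)"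
      using Suc mult_left_mono[OF ge[OF True], of "(w n)^2"] True by (simp add: algebra_simps)
    also have "\<dots> = expectation (\<lambda>\<omega>. Z \<omega> * (?W \<omega>)^2 + (2 * w n * Z \<omega> * ?W \<omega>) * \<xi> n \<omega>
        + (w n)^2 * (Z \<omega> * (\<xi> n \<omega>)^2))"
      using int cross by simp
    also have "\<dots> = expectation (\<lambda>\<omega>. Z \<omega> * (transform (\<lambda>k _. w k) m (Suc n) \<omega>)^2)"
      using True by (intro Bochner_Integration.integral_cong) (simp_all add: power2_eq_square algebra_simps)
    finally show ?thesis .
  qed simp
qed simp

text \<open>Taking the constants uniform in \<open>m\<close>, \<open>n\<close>, \<open>w\<close> and \<open>Q\<close> is what later replaces the
  martingale form of Levy's zero-one law.\<close>

lemma transform_paley_zygmund: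
  assumes "0 < \<delta>" "\<delta> \<le> 1"
  obtains \<epsilon> c where "0 < \<epsilon>" "0 < c"
    and "\<And>m n w Q. 1 \<le> m \<Longrightarrow> adapted m Q \<Longrightarrow> 0 < (\<Sum>k=m..<n. (w k)^2) \<Longrightarrow>
      (\<And>k. m \<le> k \<Longrightarrow> \<delta> * \<P>(\<omega> in M. Q \<omega>) \<le> expectation (\<lambda>\<omega>. of_bool (Q \<omega>) * (\<xi> k \<omega>)^2)) \<Longrightarrow>
      c * \<P>(\<omega> in M. Q \<omega>)
        \<le> \<P>(\<omega> in M. Q \<omega> \<and> \<epsilon> * sqrt (\<Sum>k=m..<n. (w k)^2) \<le> transform (\<lambda>k _. w k) m n \<omega>)"
proof -
  obtain s t d \<epsilon> K :: real where st: "0 \<le> s" "0 \<le> t" and "0 < \<epsilon>" and K: "0 < K"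
    and gap: "0 < s * \<delta> - 64 * t - d"
    and poly: "\<And>x. x + s * x^2 - t * x^4 - d \<le> K * of_bool (\<epsilon> \<le> x)"
    using paley_zygmund_polynomial[OF assms] by metis
  let ?c = "(s * \<delta> - 64 * t - d) / K"
  have "?c * \<P>(\<omega> in M. Q \<omega>)
        \<le> \<P>(\<omega> in M. Q \<omega> \<and> \<epsilon> * sqrt (\<Sum>k=m..<n. (w k)^2) \<le> transform (\<lambda>k _. w k) m n \<omega>)"
    if m: "1 \<le> m" and Q: "adapted m Q" and V: "0 < (\<Sum>k=m..<n. (w k)^2)"
      and ge: "\<And>k. m \<le> k \<Longrightarrow> \<delta> * \<P>(\<omega> in M. Q \<omega>) \<le> expectation (\<lambda>\<omega>. of_bool (Q \<omega>) * (\<xi> k \<omega>)^2)"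
    for m n w Q
  proof -
    define r where "r = sqrt (\<Sum>k=m..<n. (w k)^2)"
    have r: "0 < r" "r^2 = (\<Sum>k=m..<n. (w k)^2)"
      using V by (simp_all add: r_def)
    define Z :: "'a \<Rightarrow> real" where "Z = (\<lambda>\<omega>. of_bool (Q \<omega>))"
    define W where "W = transform (\<lambda>k _. w k) m n"
    have mn: "m \<le> n" using V by (rule contrapos_pp) simp
    have Z: "adapted m Z" unfolding Z_def by (rule determined_by_map[OF Q])
    have Zn: "adapted n Z" using determined_by_mono[OF Z mn] .
    have W: "adapted n W" unfolding W_def by (intro determined_transform determined_by_const)
    have Q_event: "{\<omega>\<in>space M. Q \<omega>} \<in> events" using Q by blast
    have QW: "adapted n (\<lambda>\<omega>. Q \<omega> \<and> \<epsilon> * r \<le> W \<omega>)"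
      by (intro determined_by_map2[where F = "\<lambda>a b. a \<and> \<epsilon> * r \<le> b"] W determined_by_mono[OF Q mn])
    then have QW_event: "{\<omega>\<in>space M. Q \<omega> \<and> \<epsilon> * r \<le> W \<omega>} \<in> events" by (rule determined_event)
    have prob_Q: "expectation Z = \<P>(\<omega> in M. Q \<omega>)"
      unfolding Z_def by (rule expectation_of_bool[OF Q_event])
    have e1: "expectation (\<lambda>\<omega>. Z \<omega> * W \<omega>) = 0"
      unfolding W_def by (intro transform_first_moment[OF m Z] determined_by_const)
    have e2: "\<delta> * r^2 * expectation Z \<le> expectation (\<lambda>\<omega>. Z \<omega> * (W \<omega>)^2)"
      unfolding W_def r(2) by (rule transform_second_moment_ge[OF m Z]) (use ge prob_Q Z_def in simp)
    have e4: "expectation (\<lambda>\<omega>. Z \<omega> * (W \<omega>)^4) \<le> 64 * r^4 * expectation Z"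
    proof -
      have "r^4 = (\<Sum>k=m..<n. \<bar>w k\<bar>^2)^2" by (simp flip: r(2) power_mult)
      moreover have "expectation (\<lambda>\<omega>. Z \<omega> * (W \<omega>)^4) \<le> 64 * (\<Sum>k=m..<n. \<bar>w k\<bar>^2)^2 * expectation Z"
        unfolding W_def by (rule transform_fourth_moment[OF m Z]) (simp_all add: Z_def determined_by_const)
      ultimately show ?thesis by simp
    qed
    have int: "integrable M Z" "integrable M (\<lambda>\<omega>. Z \<omega> * W \<omega>)" "integrable M (\<lambda>\<omega>. Z \<omega> * (W \<omega>)^2)"
      "integrable M (\<lambda>\<omega>. Z \<omega> * (W \<omega>)^4)"
      "integrable M (\<lambda>\<omega>. of_bool (Q \<omega> \<and> \<epsilon> * r \<le> W \<omega>) :: real)"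
      by (intro determined_integrable[of n] adapted_intros Zn W determined_by_map[OF QW])+
    have pos: "0 \<le> expectation Z" unfolding Z_def by (simp add: integral_nonneg)
    \<comment> \<open>The polynomial is applied to W / r, which on \<open>Q\<close> has mean 0,
      second moment at least \<delta> and fourth moment at most 64, in units of the probability of
      \<open>Q\<close>.\<close>
    have "(s * \<delta> - 64 * t - d) * expectation Z
        = 0 / r + s * (\<delta> * r^2 * expectation Z) / r^2 - t * (64 * r^4 * expectation Z) / r^4 - d * expectation Z"
      using r(1) by (simp add: algebra_simps)
    also have "\<dots> \<le> expectation (\<lambda>\<omega>. Z \<omega> * W \<omega>) / r + s * expectation (\<lambda>\<omega>. Z \<omega> * (W \<omega>)^2) / r^2
        - t * expectation (\<lambda>\<omega>. Z \<omega> * (W \<omega>)^4) / r^4 - d * expectation Z"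
      using e1 e2 e4 st r(1) by (intro diff_right_mono) (intro diff_mono add_mono divide_right_mono mult_left_mono; simp)
    also have "\<dots> = expectation (\<lambda>\<omega>. Z \<omega> * W \<omega> / r + s * (Z \<omega> * (W \<omega>)^2) / r^2
        - t * (Z \<omega> * (W \<omega>)^4) / r^4 - d * Z \<omega>)"
      using int by simp
    also have "\<dots> \<le> expectation (\<lambda>\<omega>. K * of_bool (Q \<omega> \<and> \<epsilon> * r \<le> W \<omega>))"
    proof (rule integral_mono)
      fix \<omega>
      have "Z \<omega> * W \<omega> / r + s * (Z \<omega> * (W \<omega>)^2) / r^2 - t * (Z \<omega> * (W \<omega>)^4) / r^4 - d * Z \<omega>
        = Z \<omega> * (W \<omega> / r + s * (W \<omega> / r)^2 - t * (W \<omega> / r)^4 - d)"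
        by (simp add: algebra_simps power_divide)
      also have "\<dots> \<le> Z \<omega> * (K * of_bool (\<epsilon> \<le> W \<omega> / r))"
        by (intro mult_left_mono poly) (simp add: Z_def)
      also have "\<dots> = K * of_bool (Q \<omega> \<and> \<epsilon> * r \<le> W \<omega>)"
        using r(1) by (simp add: Z_def pos_le_divide_eq)
      finally show "Z \<omega> * W \<omega> / r + s * (Z \<omega> * (W \<omega>)^2) / r^2 - t * (Z \<omega> * (W \<omega>)^4) / r^4 - d * Z \<omega>
        \<le> K * of_bool (Q \<omega> \<and> \<epsilon> * r \<le> W \<omega>)" .
    qed (use int in simp_all)
    also have "\<dots> = K * \<P>(\<omega> in M. Q \<omega> \<and> \<epsilon> * r \<le> W \<omega>)"
      using expectation_of_bool[OF QW_event] by simp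
    finally show ?thesis
      using K unfolding prob_Q r_def W_def by (simp add: pos_divide_le_eq mult.commute)
  qed
  moreover have "0 < ?c" using gap K by simp
  ultimately show thesis using that[of \<epsilon> ?c] \<open>0 < \<epsilon>\<close> by blast
qed

end

section \<open>Drift coefficients\<close>

text \<open>Concavity of the power function, here as the weighted mean inequality for x and
  1.\<close>

lemma powr_le_tangent:
  fixes x \<gamma> :: real
  assumes "0 \<le> \<gamma>" "\<gamma> \<le> 1" "0 < x"
  shows "x powr \<gamma> \<le> 1 + \<gamma> * (x - 1)"
  using Youngs_inequality_0[of \<gamma> "1 - \<gamma>" x 1] assms by (simp add: algebra_simps)

text \<open>By concavity the power of the ratio is at most 1 - a with a = \<gamma> / (2 k), using k
  + 1 \<le> 2 k, and (1 + a) (1 - a) \<le> 1. This quantifies the decrease of the weights, both for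
  the drift bound with \<alpha> \<le> 0 and for the summation by parts.\<close>

lemma powr_neg_ratio_ge:
  assumes "0 \<le> \<gamma>" "\<gamma> \<le> 1" "1 \<le> k"
  shows "(1 + \<gamma> / (2 * k)) * real (Suc k) powr (-\<gamma>) \<le> real k powr (-\<gamma>)"
proof -
  have k: "1 \<le> real k" using assms by simp
  have "(k / real (Suc k)) powr \<gamma> \<le> 1 + \<gamma> * (k / real (Suc k) - 1)"
    using assms by (intro powr_le_tangent) auto
  also have "\<dots> = 1 - \<gamma> / (k + 1)" using k by (simp add: field_simps)
  also have "\<dots> \<le> 1 - \<gamma> / (2 * k)" using assms k by (simp add: frac_le)
  finally have "(1 + \<gamma> / (2 * k)) * (k / real (Suc k)) powr \<gamma> \<le> (1 + \<gamma> / (2 * k)) * (1 - \<gamma> / (2 * k))"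
    using assms by (intro mult_left_mono) auto
  also have "\<dots> = 1 - (\<gamma> / (2 * k))^2" by (simp add: algebra_simps power2_eq_square)
  finally have "(1 + \<gamma> / (2 * k)) * (k / real (Suc k)) powr \<gamma> \<le> 1" by (smt (verit) zero_le_power2)
  from mult_right_mono[OF this, of "real k powr (-\<gamma>)"]
  have "(1 + \<gamma> / (2 * k)) * ((k / real (Suc k)) powr \<gamma> * real k powr (-\<gamma>)) \<le> real k powr (-\<gamma>)"
    by (simp add: mult.assoc)
  moreover have "(k / real (Suc k)) powr \<gamma> * real k powr (-\<gamma>) = real (Suc k) powr (-\<gamma>)"
    using k by (simp add: powr_divide powr_minus field_simps)
  ultimately show ?thesis by simp
qed

text \<open>The coefficient of \<open>T k\<close> in the conditional expectation of \<open>S n\<close> given the first \<open>k\<close> steps,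
  as a function of \<open>n\<close> and \<open>i = n - k\<close>.\<close>

fun drift_coeff_rev :: "real \<Rightarrow> real \<Rightarrow> nat \<Rightarrow> nat \<Rightarrow> real" where
  "drift_coeff_rev \<alpha> \<gamma> n 0 = 0"
| "drift_coeff_rev \<alpha> \<gamma> n (Suc i) = drift_coeff_rev \<alpha> \<gamma> n i
     + \<alpha> / real (n - Suc i) * (real (n - i) powr (-\<gamma>) + drift_coeff_rev \<alpha> \<gamma> n i)"

definition drift_coeff :: "real \<Rightarrow> real \<Rightarrow> nat \<Rightarrow> nat \<Rightarrow> real" where
  "drift_coeff \<alpha> \<gamma> n k = drift_coeff_rev \<alpha> \<gamma> n (n - k)"

lemma drift_coeff_self: "drift_coeff \<alpha> \<gamma> n n = 0"
  by (simp add: drift_coeff_def)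

text \<open>Step k + 1 enters the predicted value of S n with total weight (k+1) powr (-\<gamma>)
  plus the coefficient at k + 1, and its own conditional mean is \<alpha> T k / k; hence the
  recursion.\<close>

lemma drift_coeff_rec:
  assumes "k < n"
  shows "drift_coeff \<alpha> \<gamma> n k = drift_coeff \<alpha> \<gamma> n (Suc k)
    + \<alpha> / real k * (real (Suc k) powr (-\<gamma>) + drift_coeff \<alpha> \<gamma> n (Suc k))"
proof -
  have "n - k = Suc (n - Suc k)" using assms by simp
  then show ?thesis using assms by (simp add: drift_coeff_def)
qed

lemma drift_coeff_nonneg: "k \<le> n \<Longrightarrow> 0 \<le> \<alpha> \<Longrightarrow> 0 \<le> drift_coeff \<alpha> \<gamma> n k"
  by (induction k rule: inc_induct) (simp_all add: drift_coeff_self drift_coeff_rec)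

text \<open>For \<alpha> \<le> 0 the drift works against the step weights. The factor 2 / (2 +
  \<gamma>) is below 1, so the weights in \<open>drift_coeff_variance\<close> keep a fixed
  proportion of the pure power.\<close>

lemma drift_coeff_bounds_nonpos:
  assumes "k \<le> n" "1 \<le> k" "-1 \<le> \<alpha>" "\<alpha> \<le> 0" "0 < \<gamma>" "\<gamma> \<le> 1"
  shows "- (2 / (2 + \<gamma>) * real k powr (-\<gamma>)) \<le> drift_coeff \<alpha> \<gamma> n k \<and> drift_coeff \<alpha> \<gamma> n k \<le> 0"
  using assms(1,2)
proof (induction k rule: inc_induct)
  case base
  then show ?case using assms by (simp add: drift_coeff_self)
next
  case (step k)
  define h where "h = drift_coeff \<alpha> \<gamma> n (Suc k)"
  define b where "b = real (Suc k) powr (-\<gamma>)"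
  \<comment> \<open>\<theta> solves 1 - \<theta> = \<theta> \<gamma> / 2: the growth of \<theta> k
    powr (-\<gamma>) from k + 1 down to k then pays for the drift (1 - \<theta>) b / k of the worst
    case \<alpha> = -1.\<close>
  define \<theta> where "\<theta> = 2 / (2 + \<gamma>)"
  have h: "- (\<theta> * b) \<le> h" "h \<le> 0" using step unfolding h_def b_def \<theta>_def by auto
  have k: "0 < real k" using step by simp
  have \<theta>: "0 < \<theta>" "1 - \<theta> = \<theta> * \<gamma> / 2" "\<theta> < 1" using assms unfolding \<theta>_def by (auto simp: field_simps)
  have b: "0 < b" by (simp add: b_def)
  have eq: "drift_coeff \<alpha> \<gamma> n k = (1 + \<alpha> / k) * h + \<alpha> / k * b"
    using drift_coeff_rec[of k n \<alpha> \<gamma>] step(2) by (simp add: h_def b_def algebra_simps)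
  have a: "0 \<le> 1 + \<alpha> / k" "- (1 / k) \<le> \<alpha> / k" "\<alpha> / k \<le> 0"
    using assms step(4) divide_right_mono[of "-1" \<alpha> "real k"] by (auto simp: field_simps)
  have "(1 + \<alpha> / k) * h \<le> 0" "\<alpha> / k * b \<le> 0"
    using mult_nonneg_nonpos[OF a(1) h(2)] mult_nonpos_nonneg[OF a(3), of b] b by auto
  then have up: "drift_coeff \<alpha> \<gamma> n k \<le> 0" using eq by simp
  have "- (\<theta> * real k powr (-\<gamma>)) \<le> - (\<theta> * ((1 + \<gamma> / (2 * k)) * b))"
    using powr_neg_ratio_ge[of \<gamma> k] assms step(4) \<theta> unfolding b_def by simp
  also have "\<dots> = - (\<theta> * b) - (1 - \<theta>) / k * b"
    using k unfolding \<theta>(2) by (simp add: field_simps)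
  also have "\<dots> = - (\<theta> * b) + (1 - \<theta>) * b * - (1 / k)" by simp
  also have "\<dots> \<le> - (\<theta> * b) + (1 - \<theta>) * b * (\<alpha> / k)"
    using \<theta> b by (intro add_left_mono mult_left_mono a(2)) simp
  also have "\<dots> = (1 + \<alpha> / k) * (- (\<theta> * b)) + \<alpha> / k * b" by (simp add: algebra_simps)
  also have "\<dots> \<le> drift_coeff \<alpha> \<gamma> n k"
    using mult_left_mono[OF h(1) a(1)] eq by simp
  finally show ?case using up unfolding \<theta>_def by simp
qed

text \<open>The backward recursion is read forwards: from k to k + 1 the coefficient is divided by
  at most 1 + 1 / (2 k) \<le> sqrt (k / (k - 1)), up to a summable error. A large value at m thus
  decays no faster than 1 / sqrt k. The shift by 1 matters, as sqrt ((k + 1) / k) would be too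
  small.\<close>

lemma drift_coeff_decay:
  assumes "m \<le> k" "k \<le> n" "2 \<le> m" "0 \<le> \<alpha>" "\<alpha> \<le> 1/2"
  shows "drift_coeff \<alpha> \<gamma> n m * sqrt (real (m - 1)) / sqrt (real (k - 1))
      - (\<Sum>j=m..<k. real (Suc j) powr (-\<gamma>) / real j) \<le> drift_coeff \<alpha> \<gamma> n k"
  using assms(1,2)
proof (induction k rule: dec_induct)
  case base
  then show ?case using assms by simp
next
  case (step k)
  define h where "h = drift_coeff \<alpha> \<gamma> n m * sqrt (real (m - 1))"
  define s where "s = (\<Sum>j=m..<k. real (Suc j) powr (-\<gamma>) / real j)"
  define b where "b = real (Suc k) powr (-\<gamma>) / k"
  have k: "2 \<le> k" "0 < real k" using step assms by auto
  have h: "0 \<le> h" using assms step by (simp add: h_def drift_coeff_nonneg)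
  have s: "0 \<le> s" unfolding s_def by (intro sum_nonneg) simp
  have b: "0 \<le> b" unfolding b_def by simp
  have IH: "h / sqrt (real (k - 1)) - s \<le> drift_coeff \<alpha> \<gamma> n k"
    using step by (simp add: h_def s_def)
  have eq: "drift_coeff \<alpha> \<gamma> n k = (1 + \<alpha> / k) * drift_coeff \<alpha> \<gamma> n (Suc k) + \<alpha> * b"
    using drift_coeff_rec[of k n \<alpha> \<gamma>] step by (simp add: b_def algebra_simps)
  have root: "(1 + \<alpha> / k) * (1 / sqrt k) \<le> 1 / sqrt (real (k - 1))"
  proof -
    have "(1 + \<alpha> / k) \<le> 1 + 1 / (2 * real k)" using assms k by (simp add: field_simps)
    also have "\<dots> \<le> sqrt (real k / real (k - 1))"
    proof (rule real_le_rsqrt)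
      have "(1 + 1 / (2 * real k))^2 * (real k - 1) \<le> real k"
        using k by (simp add: field_simps power2_eq_square)
      then show "(1 + 1 / (2 * real k))^2 \<le> real k / real (k - 1)"
        using k by (simp add: of_nat_diff pos_le_divide_eq)
    qed
    finally show ?thesis using k by (simp add: real_sqrt_divide field_simps)
  qed
  have "(1 + \<alpha> / k) * (h / sqrt k - s - b) \<le> h / sqrt (real (k - 1)) - s - \<alpha> * b"
  proof -
    have "(1 + \<alpha> / k) * (h / sqrt k) \<le> h / sqrt (real (k - 1))"
      using mult_left_mono[OF root h] by (simp add: algebra_simps)
    moreover have "1 * s \<le> (1 + \<alpha> / k) * s" "\<alpha> * b \<le> (1 + \<alpha> / k) * b"
      using assms k by (intro mult_right_mono s b; simp add: add_increasing2)+
    ultimately show ?thesis unfolding right_diff_distrib by linarith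
  qed
  also have "\<dots> \<le> (1 + \<alpha> / k) * drift_coeff \<alpha> \<gamma> n (Suc k)" using IH eq by simp
  finally have "h / sqrt k - s - b \<le> drift_coeff \<alpha> \<gamma> n (Suc k)"
    using assms k by (simp add: mult_le_cancel_left_pos add_pos_nonneg)
  then show ?case using step(1) by (simp add: h_def s_def b_def)
qed

section \<open>Growth of the sum of squared weights\<close>

lemma filterlim_sum_inverse: "filterlim (\<lambda>n. \<Sum>k=m..<n. 1 / real (Suc k)) at_top sequentially"
proof -
  have "filterlim (\<lambda>n. - harm m + harm n :: real) at_top sequentially"
    by (rule filterlim_tendsto_add_at_top[OF tendsto_const harm_at_top])
  moreover have "(\<Sum>k=m..<n. 1 / real (Suc k)) = - harm m + harm n" if "m \<le> n" for n
    using that by (induction n rule: dec_induct) (simp_all add: harm_Suc inverse_eq_divide)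
  ultimately show ?thesis
    by (subst filterlim_cong[OF refl refl, of _ "\<lambda>n. - harm m + harm n"])
       (auto simp: eventually_sequentially)
qed

lemma filterlim_sum_powr_neg:
  assumes "\<gamma> \<le> 1/2"
  shows "filterlim (\<lambda>n. \<Sum>k=m..<n. (real (Suc k) powr (-\<gamma>))^2) at_top sequentially"
proof (rule filterlim_at_top_mono[OF filterlim_sum_inverse[of m]], rule always_eventually, intro allI sum_mono)
  fix k
  have "1 / real (Suc k) = real (Suc k) powr (-1)" by (simp add: powr_minus_divide)
  also have "\<dots> \<le> real (Suc k) powr (2 * -\<gamma>)" using assms by (intro powr_mono) auto
  also have "\<dots> = (real (Suc k) powr (-\<gamma>))^2" by (simp add: power2_eq_square flip: powr_add)
  finally show "1 / real (Suc k) \<le> (real (Suc k) powr (-\<gamma>))^2" .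
qed

lemma sum_powr_over_le:
  assumes "0 < \<gamma>" "1 \<le> m"
  obtains B where "0 \<le> B" "\<And>k. (\<Sum>j=m..<k. real (Suc j) powr (-\<gamma>) / real j) \<le> B"
proof
  have sm: "summable (\<lambda>j. real j powr (-1-\<gamma>))"
    using assms by (simp add: summable_real_powr_iff)
  show "0 \<le> (\<Sum>j. real j powr (-1-\<gamma>))" by (intro suminf_nonneg sm) simp
  fix k
  have "(\<Sum>j=m..<k. real (Suc j) powr (-\<gamma>) / real j) \<le> (\<Sum>j=m..<k. real j powr (-1-\<gamma>))"
  proof (rule sum_mono)
    fix j assume "j \<in> {m..<k}"
    then have j: "0 < real j" using assms by simp
    have "real (Suc j) powr (-\<gamma>) / real j \<le> real j powr (-\<gamma>) / real j"
      using j assms by (intro divide_right_mono powr_mono2') auto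
    also have "\<dots> = real j powr (-1-\<gamma>)"
      using j by (simp add: powr_diff powr_minus field_simps)
    finally show "real (Suc j) powr (-\<gamma>) / real j \<le> real j powr (-1-\<gamma>)" .
  qed
  also have "\<dots> \<le> (\<Sum>j. real j powr (-1-\<gamma>))"
    by (intro sum_le_suminf sm) auto
  finally show "(\<Sum>j=m..<k. real (Suc j) powr (-\<gamma>) / real j) \<le> (\<Sum>j. real j powr (-1-\<gamma>))" .
qed

text \<open>Either the coefficient \<open>h\<close> at \<open>m\<close> stays bounded along \<open>n\<close>, and then divergence of the variance
  suffices, or \<open>h\<close> is large, and then its slow decay in \<open>k\<close> alone makes the sum of the squared
  weights exceed any multiple of \<open>h\<^sup>2\<close>.\<close>

lemma drift_coeff_variance:
  assumes "-1 \<le> \<alpha>" "\<alpha> \<le> 1/2" "0 < \<gamma>" "\<gamma> \<le> 1/2" "2 \<le> m" "0 \<le> R"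
  shows "eventually (\<lambda>n. R * (1 + \<bar>drift_coeff \<alpha> \<gamma> n m\<bar>)^2
    \<le> (\<Sum>k=m..<n. (real (Suc k) powr (-\<gamma>) + drift_coeff \<alpha> \<gamma> n (Suc k))^2)) sequentially"
proof (cases "\<alpha> \<le> 0")
  case True
  define \<theta> where "\<theta> = 2 / (2 + \<gamma>)"
  have \<theta>: "0 < \<theta>" "\<theta> < 1" using assms by (auto simp: \<theta>_def)
  \<comment> \<open>The coefficient at m stays in [-1, 0], so (1 + |h|)^2 \<le> 4, and the squared
    weights retain a share (1 - \<theta>)^2 of a divergent sum.\<close>
  have "eventually (\<lambda>n. 4 * R / (1 - \<theta>)^2 \<le> (\<Sum>k=m..<n. (real (Suc k) powr (-\<gamma>))^2)) sequentially"
    using filterlim_sum_powr_neg[OF assms(4), of m] unfolding filterlim_at_top by blast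
  then show ?thesis using eventually_ge_at_top[of m]
  proof eventually_elim
    case (elim n)
    have bounds: "- (\<theta> * real k powr (-\<gamma>)) \<le> drift_coeff \<alpha> \<gamma> n k" "drift_coeff \<alpha> \<gamma> n k \<le> 0"
      if "k \<le> n" "1 \<le> k" for k
      using drift_coeff_bounds_nonpos[of k n \<alpha> \<gamma>] that assms True by (auto simp: \<theta>_def)
    have "real m powr (-\<gamma>) \<le> 1" using assms powr_mono[of "-\<gamma>" 0 "real m"] by simp
    then have "\<theta> * real m powr (-\<gamma>) \<le> 1 * 1" using \<theta> by (intro mult_mono) auto
    then have "\<bar>drift_coeff \<alpha> \<gamma> n m\<bar> \<le> 1" using bounds[of m] elim assms by auto
    then have "(1 + \<bar>drift_coeff \<alpha> \<gamma> n m\<bar>)^2 \<le> 2^2" by (intro power_mono) auto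
    then have "R * (1 + \<bar>drift_coeff \<alpha> \<gamma> n m\<bar>)^2 \<le> R * 4" using assms by (intro mult_left_mono) auto
    also have "\<dots> \<le> (1 - \<theta>)^2 * (\<Sum>k=m..<n. (real (Suc k) powr (-\<gamma>))^2)"
      using elim(1) \<theta> by (simp add: pos_divide_le_eq mult_ac)
    also have "\<dots> = (\<Sum>k=m..<n. ((1 - \<theta>) * real (Suc k) powr (-\<gamma>))^2)"
      by (simp add: sum_distrib_left power_mult_distrib)
    also have "\<dots> \<le> (\<Sum>k=m..<n. (real (Suc k) powr (-\<gamma>) + drift_coeff \<alpha> \<gamma> n (Suc k))^2)"
    proof (intro sum_mono power_mono)
      fix k assume "k \<in> {m..<n}"
      then show "(1 - \<theta>) * real (Suc k) powr (-\<gamma>) \<le> real (Suc k) powr (-\<gamma>) + drift_coeff \<alpha> \<gamma> n (Suc k)"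
        using bounds(1)[of "Suc k"] by (simp add: algebra_simps)
    qed (use \<theta> in simp)
    finally show ?case .
  qed
next
  case False
  obtain B where B: "0 \<le> B" "\<And>k. (\<Sum>j=m..<k. real (Suc j) powr (-\<gamma>) / real j) \<le> B"
    using sum_powr_over_le[of \<gamma> m] assms by auto
  \<comment> \<open>K bounds the window on which a large h alone suffices: with weights at least h /
    (2 sqrt (k+1)), the factor 16 yields R (2 h)^2 \<ge> R (1 + h)^2.\<close>
  obtain K where K: "m \<le> K" "16 * R \<le> (\<Sum>k=m..<K. 1 / real (Suc k))"
  proof -
    have "eventually (\<lambda>K. 16 * R \<le> (\<Sum>k=m..<K. 1 / real (Suc k)) \<and> m \<le> K) sequentially"
      using filterlim_sum_inverse[of m] unfolding filterlim_at_top
      by (intro eventually_conj eventually_ge_at_top) blast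
    then show thesis using that by (auto simp: eventually_sequentially)
  qed
  \<comment> \<open>Above H, the error B is at most half of h / sqrt (k+1) throughout the window,
    and 1 + h \<le> 2 h.\<close>
  define H where "H = max 1 (2 * B * sqrt K)"
  have "eventually (\<lambda>n. R * (1 + H)^2 \<le> (\<Sum>k=m..<n. (real (Suc k) powr (-\<gamma>))^2)) sequentially"
    using filterlim_sum_powr_neg[OF assms(4), of m] unfolding filterlim_at_top by blast
  then show ?thesis using eventually_ge_at_top[of K]
  proof eventually_elim
    case (elim n)
    define h where "h = drift_coeff \<alpha> \<gamma> n m"
    have nonneg: "0 \<le> drift_coeff \<alpha> \<gamma> n k" if "k \<le> n" for k
      using drift_coeff_nonneg[OF that, of \<alpha>] False by simp
    have h: "0 \<le> h" using nonneg[of m] elim K by (simp add: h_def)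
    show ?case
    proof (cases "h \<le> H")
      case True
      have "R * (1 + \<bar>h\<bar>)^2 \<le> R * (1 + H)^2"
        using True h assms by (intro mult_left_mono power_mono) auto
      also note elim(1)
      also have "(\<Sum>k=m..<n. (real (Suc k) powr (-\<gamma>))^2)
          \<le> (\<Sum>k=m..<n. (real (Suc k) powr (-\<gamma>) + drift_coeff \<alpha> \<gamma> n (Suc k))^2)"
        using nonneg by (intro sum_mono power_mono) auto
      finally show ?thesis by (simp add: h_def)
    next
      case large: False
      have "R * (1 + \<bar>h\<bar>)^2 \<le> R * (2 * h)^2"
        using large h assms by (intro mult_left_mono power_mono) (auto simp: H_def)
      also have "\<dots> = h^2 / 4 * (16 * R)" by (simp add: power2_eq_square)
      also have "\<dots> \<le> h^2 / 4 * (\<Sum>k=m..<K. 1 / real (Suc k))"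
        using K by (intro mult_left_mono) auto
      also have "\<dots> = (\<Sum>k=m..<K. (h / (2 * sqrt (Suc k)))^2)"
        by (simp add: sum_distrib_left power_divide power_mult_distrib mult.commute)
      also have "\<dots> \<le> (\<Sum>k=m..<K. (real (Suc k) powr (-\<gamma>) + drift_coeff \<alpha> \<gamma> n (Suc k))^2)"
      proof (intro sum_mono power_mono)
        fix k assume k: "k \<in> {m..<K}"
        have k0: "0 < sqrt (real k)" "sqrt k \<le> sqrt (real (Suc k))" using k assms by auto
        have "sqrt (real (Suc k)) \<le> sqrt K" using k by simp
        then have "2 * B * sqrt (real (Suc k)) \<le> 2 * B * sqrt K" using B by (intro mult_left_mono) auto
        also have "\<dots> \<le> h" using large by (simp add: H_def)
        finally have Bh: "B \<le> h / (2 * sqrt (real (Suc k)))"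
          by (simp add: pos_le_divide_eq mult_ac)
        have "h / sqrt (real (Suc k)) \<le> h * sqrt (real (m - 1)) / sqrt (real k)"
          using h k0 assms by (intro frac_le) (auto simp: mult_le_cancel_left1)
        also have "\<dots> \<le> drift_coeff \<alpha> \<gamma> n (Suc k) + B"
          using drift_coeff_decay[of m "Suc k" n \<alpha> \<gamma>] B(2)[of "Suc k"] k elim assms False
          by (simp add: h_def)
        finally have "h / sqrt (real (Suc k)) - B \<le> drift_coeff \<alpha> \<gamma> n (Suc k)" by simp
        moreover have "h / sqrt (real (Suc k)) = 2 * (h / (2 * sqrt (real (Suc k))))" by simp
        ultimately have "h / (2 * sqrt (real (Suc k))) \<le> drift_coeff \<alpha> \<gamma> n (Suc k)"
          using Bh by linarith
        then show "h / (2 * sqrt (real (Suc k))) \<le> real (Suc k) powr (-\<gamma>) + drift_coeff \<alpha> \<gamma> n (Suc k)"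
          by (smt (verit) powr_ge_zero)
      qed (use h in simp)
      also have "\<dots> \<le> (\<Sum>k=m..<n. (real (Suc k) powr (-\<gamma>) + drift_coeff \<alpha> \<gamma> n (Suc k))^2)"
        using elim by (intro sum_mono2) auto
      finally show ?thesis by (simp add: h_def)
    qed
  qed
qed

section \<open>Oscillation\<close>

context step_process begin

lemma determined_poly_sum: "n \<le> m \<Longrightarrow> adapted m (erw_poly_sum Y \<gamma> n)"
  unfolding erw_poly_sum_def[abs_def]
  by (intro determined_by_sum adapted_intros determined_by_step) auto

text \<open>Backward induction on m: replacing step m + 1, of total weight w, by \<xi> m + \<alpha>
  T m / m adds w \<alpha> / m to the coefficient of the walk, as the recursion prescribes.\<close>

lemma erw_poly_sum_decomposition:
  assumes "m \<le> n"
  shows "erw_poly_sum Y \<gamma> n \<omega> = erw_poly_sum Y \<gamma> m \<omega> + drift_coeff \<alpha> \<gamma> n m * T m \<omega>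
    + (\<Sum>k=m..<n. (real (Suc k) powr (-\<gamma>) + drift_coeff \<alpha> \<gamma> n (Suc k)) * \<xi> k \<omega>)"
  using assms
proof (induction m rule: inc_induct)
  case base
  then show ?case by (simp add: drift_coeff_self)
next
  case (step m)
  define w where "w = real (Suc m) powr (-\<gamma>) + drift_coeff \<alpha> \<gamma> n (Suc m)"
  have "drift_coeff \<alpha> \<gamma> n m = drift_coeff \<alpha> \<gamma> n (Suc m) + \<alpha> / m * w"
    using drift_coeff_rec[OF step(2)] by (simp add: w_def)
  moreover have "erw_poly_sum Y \<gamma> (Suc m) \<omega> = erw_poly_sum Y \<gamma> m \<omega> + Y (Suc m) \<omega> * real (Suc m) powr (-\<gamma>)"
    by (simp add: erw_poly_sum_def)
  ultimately have "erw_poly_sum Y \<gamma> (Suc m) \<omega> + drift_coeff \<alpha> \<gamma> n (Suc m) * T (Suc m) \<omega>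
      = erw_poly_sum Y \<gamma> m \<omega> + drift_coeff \<alpha> \<gamma> n m * T m \<omega> + w * \<xi> m \<omega>"
    by (simp add: T_Suc \<xi>_def w_def algebra_simps)
  with step show ?case
    by (simp add: sum.atLeast_Suc_lessThan w_def)
qed

text \<open>The square of \<xi> k + \<alpha> T k / k is 1, being the square of a step, and the mixed
  term has mean 0.\<close>

lemma expectation_mult_noise_power2:
  assumes "1 \<le> k" "adapted k Z"
  shows "expectation (\<lambda>\<omega>. Z \<omega> * (\<xi> k \<omega>)^2)
    = expectation Z - (\<alpha> / k)^2 * expectation (\<lambda>\<omega>. Z \<omega> * (T k \<omega>)^2)"
proof -
  have "Z \<omega> * (\<xi> k \<omega>)^2
      = Z \<omega> - (\<alpha> / k)^2 * (Z \<omega> * (T k \<omega>)^2) - 2 * \<alpha> / k * (Z \<omega> * T k \<omega> * \<xi> k \<omega>)" for \<omega>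
  proof -
    have "(\<xi> k \<omega> + \<alpha> * T k \<omega> / k)^2 = 1"
      using step_values[of "Suc k" \<omega>] by (auto simp: \<xi>_def)
    then have eq: "(\<xi> k \<omega>)^2 = 1 - (\<alpha> / k)^2 * (T k \<omega>)^2 - 2 * \<alpha> / k * (T k \<omega> * \<xi> k \<omega>)"
      by (simp add: power2_eq_square algebra_simps)
    show ?thesis unfolding eq by (simp add: algebra_simps)
  qed
  moreover have "expectation (\<lambda>\<omega>. Z \<omega> * T k \<omega> * \<xi> k \<omega>) = 0"
    using assms by (intro expectation_mult_noise adapted_intros determined_T) auto
  moreover have "integrable M Z" "integrable M (\<lambda>\<omega>. Z \<omega> * (T k \<omega>)^2)"
    "integrable M (\<lambda>\<omega>. Z \<omega> * T k \<omega> * \<xi> k \<omega>)"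
    by (intro determined_integrable[of "Suc k"] adapted_intros determined_T determined_noise
        determined_by_mono[OF assms(2)]; simp)+
  ultimately show ?thesis by simp
qed

lemma expectation_mult_T_power2:
  assumes "1 \<le> k" "adapted k Z"
  shows "expectation (\<lambda>\<omega>. Z \<omega> * (T (Suc k) \<omega>)^2)
    = (1 + 2 * \<alpha> / k) * expectation (\<lambda>\<omega>. Z \<omega> * (T k \<omega>)^2) + expectation Z"
proof -
  have eq: "Z \<omega> * (T (Suc k) \<omega>)^2 = Z \<omega> * (T k \<omega>)^2 + 2 * (Z \<omega> * T k \<omega> * Y (Suc k) \<omega>) + Z \<omega>" for \<omega>
    using step_values[of "Suc k" \<omega>] by (auto simp: T_Suc power2_eq_square algebra_simps)
  have "expectation (\<lambda>\<omega>. Z \<omega> * T k \<omega> * Y (Suc k) \<omega>)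
      = \<alpha> / k * expectation (\<lambda>\<omega>. Z \<omega> * T k \<omega> * T k \<omega>)"
    using assms by (intro expectation_mult_step adapted_intros determined_T) auto
  moreover have "integrable M Z" "integrable M (\<lambda>\<omega>. Z \<omega> * (T k \<omega>)^2)"
    "integrable M (\<lambda>\<omega>. Z \<omega> * T k \<omega> * Y (Suc k) \<omega>)"
    by (intro determined_integrable[of "Suc k"] adapted_intros determined_T determined_by_step
        determined_by_mono[OF assms(2)]; simp)+
  ultimately have "expectation (\<lambda>\<omega>. Z \<omega> * (T k \<omega>)^2 + 2 * (Z \<omega> * T k \<omega> * Y (Suc k) \<omega>) + Z \<omega>)
      = expectation (\<lambda>\<omega>. Z \<omega> * (T k \<omega>)^2) + 2 * (\<alpha> / k * expectation (\<lambda>\<omega>. Z \<omega> * (T k \<omega>)^2))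
        + expectation Z"
    by (simp add: power2_eq_square mult.assoc)
  then show ?thesis unfolding eq by (simp add: algebra_simps)
qed

text \<open>For 0 \<le> \<alpha> the drift is at most 1/2 pointwise. For \<alpha> < 0 the second
  moment of T grows by at most 1 per step, so (T k / k)^2 averages at most 1/2 from k = 2 m + 2 on,
  even if |T m| = m. Some delay is unavoidable: for \<alpha> = -1 the noise at time 1 vanishes
  almost surely.\<close>

lemma noise_second_moment_ge_half:
  assumes "\<alpha> \<le> 1/2" "1 \<le> m" "2 * m + 2 \<le> k" "adapted m Z" "\<And>\<omega>. 0 \<le> Z \<omega>"
  shows "1/2 * expectation Z \<le> expectation (\<lambda>\<omega>. Z \<omega> * (\<xi> k \<omega>)^2)"
proof -
  have Z: "adapted j Z" if "m \<le> j" for j using determined_by_mono[OF assms(4) that] .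
  have int: "integrable M Z" using determined_integrable[OF assms(4)] .
  have intT: "integrable M (\<lambda>\<omega>. Z \<omega> * (T j \<omega>)^2)" if "m \<le> j" for j
    using that by (intro determined_integrable[of j] adapted_intros determined_T Z) auto
  have EZ: "0 \<le> expectation Z" using assms(5) by (simp add: integral_nonneg)
  have "(\<alpha> / k)^2 * expectation (\<lambda>\<omega>. Z \<omega> * (T k \<omega>)^2) \<le> 1/2 * expectation Z"
  proof (cases "0 \<le> \<alpha>")
    case True
    have "(\<alpha> / k)^2 * (Z \<omega> * (T k \<omega>)^2) \<le> 1/2 * Z \<omega>" for \<omega>
    proof -
      have "\<bar>\<alpha> * T k \<omega> / k\<bar> \<le> 1/2"
        by (rule order.trans[OF abs_drift_le]) (use assms True in simp)
      then have "\<bar>\<alpha> * T k \<omega> / k\<bar>^2 \<le> (1/2)^2" by (intro power_mono) auto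
      also have "(1/2)^2 \<le> (1/2 :: real)" by (simp add: power2_eq_square)
      finally have "(\<alpha> * T k \<omega> / k)^2 \<le> 1/2" unfolding power2_abs .
      from mult_left_mono[OF this assms(5)[of \<omega>]] show ?thesis
        by (simp add: power_mult_distrib power_divide mult_ac)
    qed
    then have "expectation (\<lambda>\<omega>. (\<alpha> / k)^2 * (Z \<omega> * (T k \<omega>)^2)) \<le> expectation (\<lambda>\<omega>. 1/2 * Z \<omega>)"
      using int intT[of k] assms by (intro integral_mono) auto
    then show ?thesis by simp
  next
    case False
    have growth: "expectation (\<lambda>\<omega>. Z \<omega> * (T j \<omega>)^2) \<le> (real m^2 + (real j - real m)) * expectation Z"
      if "m \<le> j" for j
      using that
    proof (induction j rule: dec_induct)
      case base
      have "Z \<omega> * (T m \<omega>)^2 \<le> real m^2 * Z \<omega>" for \<omega>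
        using mult_left_mono[OF power_mono[OF abs_T_le[of m \<omega>], of 2] assms(5)[of \<omega>]]
        by (simp add: mult.commute)
      then have "expectation (\<lambda>\<omega>. Z \<omega> * (T m \<omega>)^2) \<le> expectation (\<lambda>\<omega>. real m^2 * Z \<omega>)"
        using int intT[of m] by (intro integral_mono) auto
      then show ?case by simp
    next
      case (step j)
      have "0 \<le> expectation (\<lambda>\<omega>. Z \<omega> * (T j \<omega>)^2)" using assms(5) by (simp add: integral_nonneg)
      then have "2 * \<alpha> / j * expectation (\<lambda>\<omega>. Z \<omega> * (T j \<omega>)^2) \<le> 0"
        using False by (intro mult_nonpos_nonneg) (auto simp: divide_nonpos_nonneg)
      then have "expectation (\<lambda>\<omega>. Z \<omega> * (T (Suc j) \<omega>)^2) \<le> expectation (\<lambda>\<omega>. Z \<omega> * (T j \<omega>)^2) + expectation Z"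
        using expectation_mult_T_power2[OF _ Z[of j]] step assms by (simp add: algebra_simps)
      then show ?case using step by (simp add: algebra_simps)
    qed
    have k: "0 < real k" "2 * real m + 2 \<le> real k" using assms by auto
    have "real m^2 \<le> real m * k" unfolding power2_eq_square using k by (intro mult_left_mono) auto
    moreover have "(2 * real m + 2) * k \<le> real k^2"
      unfolding power2_eq_square using k by (intro mult_right_mono) auto
    ultimately have le: "real m^2 + (real k - real m) \<le> 1/2 * real k^2"
      by (simp add: algebra_simps)
    have "\<bar>\<alpha>\<bar>^2 \<le> 1^2" using alpha_bounds False by (intro power_mono) auto
    then have "(\<alpha> / k)^2 \<le> 1 / real k^2" by (simp add: power_divide divide_right_mono)
    then have "(\<alpha> / k)^2 * expectation (\<lambda>\<omega>. Z \<omega> * (T k \<omega>)^2)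
        \<le> 1 / real k^2 * ((real m^2 + (real k - real m)) * expectation Z)"
      using growth[of k] assms by (intro mult_mono) (auto simp: integral_nonneg)
    also have "\<dots> \<le> 1 / real k^2 * ((1/2 * real k^2) * expectation Z)"
      using le EZ by (intro mult_left_mono mult_right_mono) auto
    also have "\<dots> = 1/2 * expectation Z" using k by simp
    finally show ?thesis .
  qed
  then show ?thesis using expectation_mult_noise_power2[of k Z] Z[of k] assms by simp
qed

text \<open>The sign \<sigma> treats both directions at once. If K has not been exceeded up to time
  m, it is exceeded later with conditional probability at least c; letting m grow, the probability p
  of never exceeding K satisfies p \<le> (1 - c) p.\<close>

lemma poly_sum_unbounded:
  assumes "\<alpha> \<le> 1/2" "0 < \<gamma>" "\<gamma> \<le> 1/2" "\<bar>\<sigma>\<bar> = 1"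
  shows "AE \<omega> in M. \<exists>n. K < \<sigma> * erw_poly_sum Y \<gamma> n \<omega>"
proof -
  obtain \<epsilon> c :: real where "0 < \<epsilon>" "0 < c"
    and pz: "\<And>m n w Q. 1 \<le> m \<Longrightarrow> adapted m Q \<Longrightarrow> 0 < (\<Sum>k=m..<n. (w k)^2) \<Longrightarrow>
      (\<And>k. m \<le> k \<Longrightarrow> 1/2 * \<P>(\<omega> in M. Q \<omega>) \<le> expectation (\<lambda>\<omega>. of_bool (Q \<omega>) * (\<xi> k \<omega>)^2)) \<Longrightarrow>
      c * \<P>(\<omega> in M. Q \<omega>)
        \<le> \<P>(\<omega> in M. Q \<omega> \<and> \<epsilon> * sqrt (\<Sum>k=m..<n. (w k)^2) \<le> transform (\<lambda>k _. w k) m n \<omega>)"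
    by (rule transform_paley_zygmund[of "1/2"]) auto
  let ?S = "erw_poly_sum Y \<gamma>"
  define Q where "Q = (\<lambda>m \<omega>. \<forall>n\<in>{..m}. \<sigma> * ?S n \<omega> \<le> K)"
  have Q: "adapted m (Q m)" for m
    unfolding Q_def
    by (intro determined_by_Ball determined_by_map[where F = "\<lambda>x. \<sigma> * x \<le> K"] determined_poly_sum) auto
  have Q_event: "{\<omega>\<in>space M. Q m \<omega>} \<in> events" for m using Q by (rule determined_event)
  have decr: "\<P>(\<omega> in M. \<forall>m. Q m \<omega>) \<le> (1 - c) * \<P>(\<omega> in M. Q m \<omega>)" if "1 \<le> m" for m
  proof -
    \<comment> \<open>The noise sum starts at \<open>m'\<close>, while the conditioning event
      \<open>Q m\<close> depends on m steps only: this is the gap that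
      \<open>noise_second_moment_ge_half\<close> requires.\<close>
    define m' where "m' = 2 * m + 2"
    define w where "w = (\<lambda>n k. \<sigma> * (real (Suc k) powr (-\<gamma>) + drift_coeff \<alpha> \<gamma> n (Suc k)))"
    define V where "V = (\<lambda>n. \<Sum>k=m'..<n. (w n k)^2)"
    \<comment> \<open>At time \<open>m'\<close> both the weighted sum and the walk are at most
      \<open>m'\<close> in absolute value. Noise of size L (1 + |h|) therefore outweighs everything
      accumulated so far and still lifts the sum above K.\<close>
    define L where "L = max K 0 + m' + 1"
    have L: "0 < L" "m' \<le> L" "K + m' < L" by (auto simp: L_def)
    have V_eq: "V n = (\<Sum>k=m'..<n. (real (Suc k) powr (-\<gamma>) + drift_coeff \<alpha> \<gamma> n (Suc k))^2)" for n
    proof -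
      have "\<sigma>^2 = 1" using assms(4) by (metis one_power2 power2_abs)
      then show ?thesis by (simp add: V_def w_def power_mult_distrib)
    qed
    have "eventually (\<lambda>n. (L / \<epsilon>)^2 * (1 + \<bar>drift_coeff \<alpha> \<gamma> n m'\<bar>)^2 \<le> V n \<and> m' \<le> n) sequentially"
      unfolding V_eq using assms alpha_bounds
      by (intro eventually_conj eventually_ge_at_top drift_coeff_variance) (auto simp: m'_def)
    then obtain n where n: "(L / \<epsilon>)^2 * (1 + \<bar>drift_coeff \<alpha> \<gamma> n m'\<bar>)^2 \<le> V n" "m' \<le> n"
      by (auto simp: eventually_sequentially)
    define h where "h = drift_coeff \<alpha> \<gamma> n m'"
    have "0 < (L / \<epsilon>)^2 * (1 + \<bar>h\<bar>)^2"
      using L \<open>0 < \<epsilon>\<close> by (intro mult_pos_pos zero_less_power) auto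
    then have Vpos: "0 < V n" using n by (simp add: h_def)
    have "((L / \<epsilon>) * (1 + \<bar>h\<bar>))^2 \<le> V n" using n unfolding h_def power_mult_distrib by simp
    then have "(L / \<epsilon>) * (1 + \<bar>h\<bar>) \<le> sqrt (V n)" by (rule real_le_rsqrt)
    then have sqrtV: "L * (1 + \<bar>h\<bar>) \<le> \<epsilon> * sqrt (V n)"
      using \<open>0 < \<epsilon>\<close> by (simp add: field_simps)
    have exceed: "K < \<sigma> * ?S n \<omega>" if "\<epsilon> * sqrt (V n) \<le> transform (\<lambda>k _. w n k) m' n \<omega>" for \<omega>
    proof -
      have "\<bar>?S m' \<omega>\<bar> \<le> (\<Sum>k=1..m'. 1)"
        unfolding erw_poly_sum_def
      proof (intro order.trans[OF sum_abs] sum_mono)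
        fix k assume "k \<in> {1..m'}"
        then show "\<bar>Y k \<omega> * real k powr (-\<gamma>)\<bar> \<le> 1"
          using powr_mono[of "-\<gamma>" 0 "real k"] assms(2) by (simp add: abs_mult)
      qed
      then have "\<bar>?S m' \<omega>\<bar> \<le> m'" by simp
      moreover have "\<bar>h * T m' \<omega>\<bar> \<le> \<bar>h\<bar> * L"
        unfolding abs_mult using abs_T_le[of m' \<omega>] L by (intro mult_left_mono) auto
      ultimately have "\<bar>?S m' \<omega> + h * T m' \<omega>\<bar> \<le> m' + \<bar>h\<bar> * L"
        using abs_triangle_ineq[of "?S m' \<omega>" "h * T m' \<omega>"] by linarith
      then have "\<bar>\<sigma> * (?S m' \<omega> + h * T m' \<omega>)\<bar> \<le> m' + \<bar>h\<bar> * L"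
        using assms(4) by (simp add: abs_mult)
      moreover have "\<sigma> * ?S n \<omega> = \<sigma> * (?S m' \<omega> + h * T m' \<omega>) + transform (\<lambda>k _. w n k) m' n \<omega>"
        unfolding erw_poly_sum_decomposition[OF n(2)] h_def w_def
        by (simp add: algebra_simps sum_distrib_left)
      ultimately show ?thesis using that sqrtV L(3) by (simp add: algebra_simps)
    qed
    have Qm: "adapted m' (Q m)" using determined_by_mono[OF Q] by (simp add: m'_def)
    have "c * \<P>(\<omega> in M. Q m \<omega>) \<le> \<P>(\<omega> in M. Q m \<omega> \<and> \<epsilon> * sqrt (V n) \<le> transform (\<lambda>k _. w n k) m' n \<omega>)"
      unfolding V_def
    proof (rule pz[OF _ Qm])
      fix k assume k: "m' \<le> k"
      show "1/2 * \<P>(\<omega> in M. Q m \<omega>) \<le> expectation (\<lambda>\<omega>. of_bool (Q m \<omega>) * (\<xi> k \<omega>)^2)"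
        unfolding expectation_of_bool[OF Q_event, symmetric]
        using \<open>1 \<le> m\<close> k assms(1) determined_by_map[OF Q]
        by (intro noise_second_moment_ge_half[of m]) (auto simp: m'_def)
    qed (use Vpos in \<open>auto simp: V_def m'_def\<close>)
    also have "\<dots> \<le> \<P>(\<omega> in M. Q m \<omega> \<and> \<not> Q n \<omega>)"
    proof (rule finite_measure_mono)
      show "{\<omega>\<in>space M. Q m \<omega> \<and> \<not> Q n \<omega>} \<in> events"
        using Q_event[of m] Q_event[of n] by (auto intro!: sets.sets_Collect)
    qed (use exceed in \<open>auto simp: Q_def not_le\<close>)
    also have "\<dots> = \<P>(\<omega> in M. Q m \<omega>) - \<P>(\<omega> in M. Q n \<omega>)"
    proof -
      have "{\<omega>\<in>space M. Q m \<omega> \<and> \<not> Q n \<omega>} = {\<omega>\<in>space M. Q m \<omega>} - {\<omega>\<in>space M. Q n \<omega>}" by auto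
      moreover have "{\<omega>\<in>space M. Q n \<omega>} \<subseteq> {\<omega>\<in>space M. Q m \<omega>}"
        using n(2) by (auto simp: Q_def m'_def)
      ultimately show ?thesis using finite_measure_Diff[OF Q_event Q_event, of n m] by simp
    qed
    finally have "\<P>(\<omega> in M. Q n \<omega>) \<le> (1 - c) * \<P>(\<omega> in M. Q m \<omega>)" by (simp add: algebra_simps)
    moreover have "\<P>(\<omega> in M. \<forall>m. Q m \<omega>) \<le> \<P>(\<omega> in M. Q n \<omega>)"
      by (rule finite_measure_mono[OF _ Q_event]) auto
    ultimately show ?thesis by simp
  qed
  have lim: "(\<lambda>m. \<P>(\<omega> in M. Q m \<omega>)) \<longlonglongrightarrow> \<P>(\<omega> in M. \<forall>m. Q m \<omega>)"
  proof -
    have "(\<lambda>m. prob {\<omega>\<in>space M. Q m \<omega>}) \<longlonglongrightarrow> prob (\<Inter>m. {\<omega>\<in>space M. Q m \<omega>})"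
      using Q_event by (intro finite_Lim_measure_decseq) (auto simp: decseq_def Q_def)
    moreover have "(\<Inter>m. {\<omega>\<in>space M. Q m \<omega>}) = {\<omega>\<in>space M. \<forall>m. Q m \<omega>}" by auto
    ultimately show ?thesis by simp
  qed
  have "\<P>(\<omega> in M. \<forall>m. Q m \<omega>) \<le> (1 - c) * \<P>(\<omega> in M. \<forall>m. Q m \<omega>)"
    using decr by (intro LIMSEQ_le_const[OF tendsto_mult_left[OF lim]] exI[of _ 1]) auto
  then have "c * \<P>(\<omega> in M. \<forall>m. Q m \<omega>) \<le> 0" by (simp add: algebra_simps)
  then have zero: "\<P>(\<omega> in M. \<forall>m. Q m \<omega>) = 0"
    using \<open>0 < c\<close> by (simp add: mult_le_0_iff order_antisym)
  have "{\<omega>\<in>space M. \<forall>m. Q m \<omega>} \<in> events"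
    using Q_event by (intro sets.sets_Collect_countable_All) auto
  with zero have "AE \<omega> in M. \<not> (\<forall>m. Q m \<omega>)"
    by (subst AE_iff_measurable[OF _ refl]) (simp_all add: emeasure_eq_measure)
  then show ?thesis by eventually_elim (auto simp: Q_def not_le)
qed

end

lemma limsup_eq_infinity:
  fixes f :: "nat \<Rightarrow> real"
  assumes "\<And>K. \<exists>n. K < f n"
  shows "limsup (\<lambda>n. ereal (f n)) = \<infinity>"
proof (rule ccontr)
  assume "limsup (\<lambda>n. ereal (f n)) \<noteq> \<infinity>"
  then obtain K where "limsup (\<lambda>n. ereal (f n)) < ereal K"
    by (metis less_PInf_Ex_of_nat ereal_less_eq(1) less_le real_of_ereal.elims top_ereal_def)
  then have "eventually (\<lambda>n. ereal (f n) < ereal K) sequentially" by (rule Limsup_lessD)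
  then obtain N where N: "\<And>n. N \<le> n \<Longrightarrow> f n < K" by (auto simp: eventually_sequentially)
  \<comment> \<open>Including the initial segment in the maximum forces n beyond N.\<close>
  obtain n where n: "Max (insert K (f ` {..N})) < f n" using assms by blast
  then have "K < f n" "f n \<notin> f ` {..N}" by (auto simp: Max_less_iff)
  then show False using N[of n] by (cases "n \<le> N") auto
qed

lemma (in step_process) poly_sum_oscillates:
  assumes "\<alpha> \<le> 1/2" "0 < \<gamma>" "\<gamma> \<le> 1/2"
  shows "AE \<omega> in M. liminf (\<lambda>n. ereal (erw_poly_sum Y \<gamma> n \<omega>)) = -\<infinity>
    \<and> limsup (\<lambda>n. ereal (erw_poly_sum Y \<gamma> n \<omega>)) = \<infinity>"
proof -
  have "AE \<omega> in M. \<forall>K :: nat. (\<exists>n. K < 1 * erw_poly_sum Y \<gamma> n \<omega>) \<and> (\<exists>n. K < -1 * erw_poly_sum Y \<gamma> n \<omega>)"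
    by (intro AE_all_countable[THEN iffD2] allI AE_conjI poly_sum_unbounded assms) auto
  then show ?thesis
  proof eventually_elim
    case (elim \<omega>)
    have ex: "\<exists>n. K < erw_poly_sum Y \<gamma> n \<omega>" "\<exists>n. K < - erw_poly_sum Y \<gamma> n \<omega>" for K
      using elim reals_Archimedean2[of K] by (metis less_trans mult_1 mult_minus1)+
    have "limsup (\<lambda>n. ereal (erw_poly_sum Y \<gamma> n \<omega>)) = \<infinity>"
      by (rule limsup_eq_infinity) (rule ex)
    moreover have "limsup (\<lambda>n. ereal (- erw_poly_sum Y \<gamma> n \<omega>)) = \<infinity>"
      by (rule limsup_eq_infinity) (rule ex)
    ultimately show ?case using ereal_Limsup_uminus[of sequentially "\<lambda>n. ereal (erw_poly_sum Y \<gamma> n \<omega>)"]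
      by simp (metis ereal_uminus_uminus)
  qed
qed

section \<open>Convergence\<close>

text \<open>Bernoulli's inequality for real exponents, from the concave case with exponent 1 /
  r.\<close>

lemma powr_ge_tangent:
  fixes x r :: real
  assumes "1 \<le> r" "0 \<le> x"
  shows "1 + r * x \<le> (1 + x) powr r"
proof -
  have "(1 + r * x) powr (1 / r) \<le> 1 + x"
    using powr_le_tangent[of "1 / r" "1 + r * x"] assms by (simp add: add_pos_nonneg)
  then have "((1 + r * x) powr (1 / r)) powr r \<le> (1 + x) powr r"
    using assms by (intro powr_mono2) auto
  then show ?thesis using assms by (simp add: powr_powr add_pos_nonneg)
qed

lemma (in prob_space) AE_summable_if_summable_expectation:
  fixes f :: "nat \<Rightarrow> 'a \<Rightarrow> real"
  assumes int: "\<And>k. integrable M (f k)" and sm: "summable (\<lambda>k. expectation (\<lambda>\<omega>. \<bar>f k \<omega>\<bar>))"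
  shows "AE \<omega> in M. summable (\<lambda>k. f k \<omega>)"
proof -
  have [measurable]: "f k \<in> borel_measurable M" for k using int by auto
  have "(\<integral>\<^sup>+\<omega>. (\<Sum>k. ennreal \<bar>f k \<omega>\<bar>) \<partial>M) = (\<Sum>k. \<integral>\<^sup>+\<omega>. ennreal \<bar>f k \<omega>\<bar> \<partial>M)"
    by (intro nn_integral_suminf) measurable
  also have "\<dots> = (\<Sum>k. ennreal (expectation (\<lambda>\<omega>. \<bar>f k \<omega>\<bar>)))"
    using int by (intro suminf_cong nn_integral_eq_integral) auto
  also have "\<dots> = ennreal (\<Sum>k. expectation (\<lambda>\<omega>. \<bar>f k \<omega>\<bar>))"
    by (intro suminf_ennreal2 sm) simp
  finally have "AE \<omega> in M. (\<Sum>k. ennreal \<bar>f k \<omega>\<bar>) \<noteq> \<infinity>"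
    by (intro nn_integral_PInf_AE) auto
  then show ?thesis
  proof eventually_elim
    case (elim \<omega>)
    then have "summable (\<lambda>k. \<bar>f k \<omega>\<bar>)" by (intro summable_suminf_not_top) auto
    then show ?case by (rule summable_rabs_cancel)
  qed
qed

lemma (in prob_space) prob_tendsto_0:
  assumes ev: "\<And>n. {\<omega>\<in>space M. P n \<omega>} \<in> events"
    and ae: "AE \<omega> in M. eventually (\<lambda>n. \<not> P n \<omega>) sequentially"
  shows "(\<lambda>n. \<P>(\<omega> in M. P n \<omega>)) \<longlonglongrightarrow> 0"
proof -
  have "(\<lambda>n. expectation (\<lambda>\<omega>. indicator {\<omega>\<in>space M. P n \<omega>} \<omega> :: real)) \<longlonglongrightarrow> expectation (\<lambda>\<omega>. 0)"
  proof (rule integral_dominated_convergence[where w = "\<lambda>_. 1"])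
    show "AE \<omega> in M. (\<lambda>n. indicator {\<omega>\<in>space M. P n \<omega>} \<omega> :: real) \<longlonglongrightarrow> 0"
      using ae
    proof eventually_elim
      case (elim \<omega>)
      then show ?case by (intro tendsto_eventually) (auto elim: eventually_mono)
    qed
  qed (use ev in \<open>auto intro: borel_measurable_indicator\<close>)
  then show ?thesis using ev by simp
qed

section \<open>Kolmogorov's maximal inequality and convergence of noise sums\<close>

context step_process begin

text \<open>Stopping is put into the weights: \<open>v k\<close> is 0 once the level has been
  reached, which the first k steps determine. The transform of \<open>v\<close> at n then equals the
  original one at the first passage time, so its second moment bounds the probability.\<close>

lemma transform_maximal_inequality:
  assumes "1 \<le> m" "0 < \<epsilon>"
  shows "\<P>(\<omega> in M. \<exists>j\<in>{m..n}. \<epsilon> \<le> \<bar>transform (\<lambda>k _. w k) m j \<omega>\<bar>) \<le> 4 * (\<Sum>k=m..<n. (w k)^2) / \<epsilon>^2"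
proof -
  let ?W = "transform (\<lambda>k _. w k) m"
  define P where "P = (\<lambda>k \<omega>. \<exists>j\<in>{m..k}. \<epsilon> \<le> \<bar>?W j \<omega>\<bar>)"
  have P: "adapted k (P k)" for k
    unfolding P_def
  proof (intro determined_by_Bex determined_by_map[where F = "\<lambda>x. \<epsilon> \<le> \<bar>x\<bar>"])
    fix j assume "j \<in> {m..k}"
    moreover have "adapted j (?W j)" by (intro determined_transform determined_by_const)
    ultimately show "adapted k (?W j)" by (auto intro: determined_by_mono)
  qed
  define v where "v = (\<lambda>k \<omega>. if P k \<omega> then 0 else w k)"
  have v: "adapted k (v k)" for k
    unfolding v_def by (rule determined_by_map[OF P, where F = "\<lambda>b. if b then 0 else w k"])
  have stopped: "\<epsilon> \<le> \<bar>transform v m n \<omega>\<bar>" if "P n \<omega>" for \<omega>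
  proof -
    define j where "j = (LEAST j. m \<le> j \<and> \<epsilon> \<le> \<bar>?W j \<omega>\<bar>)"
    have ex: "\<exists>j. m \<le> j \<and> \<epsilon> \<le> \<bar>?W j \<omega>\<bar>" using that by (auto simp: P_def)
    have j: "m \<le> j" "\<epsilon> \<le> \<bar>?W j \<omega>\<bar>" using LeastI_ex[OF ex] by (auto simp: j_def)
    have min: "\<not> \<epsilon> \<le> \<bar>?W i \<omega>\<bar>" if "m \<le> i" "i < j" for i
      using not_less_Least[of i "\<lambda>j. m \<le> j \<and> \<epsilon> \<le> \<bar>?W j \<omega>\<bar>"] that by (auto simp: j_def)
    have "j \<le> n" using that min unfolding P_def by (metis atLeastAtMost_iff not_le order_trans)
    have "transform v m n \<omega> = transform v m j \<omega> + (\<Sum>k=j..<n. v k \<omega> * \<xi> k \<omega>)"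
      using j \<open>j \<le> n\<close> by (simp add: sum.atLeastLessThan_concat)
    also have "(\<Sum>k=j..<n. v k \<omega> * \<xi> k \<omega>) = 0"
      using j by (intro sum.neutral) (auto simp: v_def P_def)
    also have "transform v m j \<omega> = ?W j \<omega>"
    proof (intro sum.cong refl)
      fix k assume "k \<in> {m..<j}"
      then have "\<not> P k \<omega>" using min by (auto simp: P_def)
      then show "v k \<omega> * \<xi> k \<omega> = w k * \<xi> k \<omega>" by (simp add: v_def)
    qed
    finally show ?thesis using j by simp
  qed
  have ev: "{\<omega>\<in>space M. P n \<omega>} \<in> events" using P by (rule determined_event)
  have int: "integrable M (\<lambda>\<omega>. (transform v m n \<omega>)^2)" "integrable M (\<lambda>\<omega>. of_bool (P n \<omega>) :: real)"
    by (intro determined_integrable[of n] determined_by_map[where F = "\<lambda>x. x^2"] determined_transform v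
        determined_by_map[OF P])+
  have "\<epsilon>^2 * \<P>(\<omega> in M. P n \<omega>) = expectation (\<lambda>\<omega>. \<epsilon>^2 * of_bool (P n \<omega>))"
    using expectation_of_bool[OF ev] by simp
  also have "\<dots> \<le> expectation (\<lambda>\<omega>. (transform v m n \<omega>)^2)"
  proof (rule integral_mono)
    fix \<omega>
    have "\<epsilon>^2 \<le> (transform v m n \<omega>)^2" if "P n \<omega>"
      using power_mono[OF stopped[OF that], of 2] assms by simp
    then show "\<epsilon>^2 * of_bool (P n \<omega>) \<le> (transform v m n \<omega>)^2" by auto
  qed (use int in auto)
  also have "\<dots> = expectation (\<lambda>\<omega>. 1 * (transform v m n \<omega>)^2)" by simp
  also have "\<dots> \<le> 4 * (\<Sum>k=m..<n. \<bar>w k\<bar>^2) * expectation (\<lambda>_. 1)"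
    by (rule transform_second_moment[OF assms(1) determined_by_const _ v]) (auto simp: v_def)
  finally show ?thesis
    using assms(2) by (simp add: P_def pos_le_divide_eq mult.commute prob_space)
qed

lemma transform_measurable [measurable]:
  "transform (\<lambda>k _. w k) m j \<in> borel_measurable M"
  by (rule determined_borel[of j]) (intro determined_transform determined_by_const)

lemma transform_tail_maximal_inequality:
  assumes "1 \<le> m" "0 < \<epsilon>" "summable (\<lambda>k. (w k)^2)"
  shows "\<P>(\<omega> in M. \<exists>j\<ge>m. \<epsilon> \<le> \<bar>transform (\<lambda>k _. w k) m j \<omega>\<bar>) \<le> 4 * (\<Sum>k. (w (k + m))^2) / \<epsilon>^2"
proof -
  let ?W = "transform (\<lambda>k _. w k) m"
  have "(\<lambda>n. prob {\<omega>\<in>space M. \<exists>j\<in>{m..n}. \<epsilon> \<le> \<bar>?W j \<omega>\<bar>})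
      \<longlonglongrightarrow> prob (\<Union>n. {\<omega>\<in>space M. \<exists>j\<in>{m..n}. \<epsilon> \<le> \<bar>?W j \<omega>\<bar>})"
    by (intro finite_Lim_measure_incseq) (auto simp: incseq_def intro: order_trans)
  moreover have "(\<Union>n. {\<omega>\<in>space M. \<exists>j\<in>{m..n}. \<epsilon> \<le> \<bar>?W j \<omega>\<bar>}) = {\<omega>\<in>space M. \<exists>j\<ge>m. \<epsilon> \<le> \<bar>?W j \<omega>\<bar>}"
    by auto (metis atLeastAtMost_iff order_refl)
  moreover have "prob {\<omega>\<in>space M. \<exists>j\<in>{m..n}. \<epsilon> \<le> \<bar>?W j \<omega>\<bar>} \<le> 4 * (\<Sum>k. (w (k + m))^2) / \<epsilon>^2" for n
  proof -
    have "(\<Sum>k=m..<n. (w k)^2) \<le> (\<Sum>k. (w (k + m))^2)"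
    proof (cases "m \<le> n")
      case True
      then have "(\<Sum>k=m..<n. (w k)^2) = (\<Sum>k<n - m. (w (k + m))^2)"
        using sum.shift_bounds_nat_ivl[of "\<lambda>k. (w k)^2" 0 m "n - m"] by (simp add: atLeast0LessThan)
      also have "\<dots> \<le> (\<Sum>k. (w (k + m))^2)"
        using assms(3) by (intro sum_le_suminf summable_ignore_initial_segment) auto
      finally show ?thesis .
    next
      case False
      then show ?thesis using assms(3) by (auto intro!: suminf_nonneg summable_ignore_initial_segment)
    qed
    then have "4 * (\<Sum>k=m..<n. (w k)^2) / \<epsilon>^2 \<le> 4 * (\<Sum>k. (w (k + m))^2) / \<epsilon>^2"
      by (intro divide_right_mono mult_left_mono) auto
    then show ?thesis
      using transform_maximal_inequality[OF assms(1,2), of n w] by linarith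
  qed
  ultimately show ?thesis by (intro LIMSEQ_le_const2) auto
qed

text \<open>The tail of the series of squares bounds the probability that the sum ever moves by
  \<epsilon> after m. For every \<epsilon> there is thus almost surely an m after which it never
  does; taking \<epsilon> = 1 / (i + 1) gives the Cauchy property.\<close>

lemma transform_convergent:
  assumes "summable (\<lambda>k. (w k)^2)"
  shows "AE \<omega> in M. convergent (\<lambda>n. transform (\<lambda>k _. w k) 1 n \<omega>)"
proof -
  let ?W = "transform (\<lambda>k _. w k)"
  define bad where "bad = (\<lambda>\<epsilon> m \<omega>. \<exists>j\<ge>m. \<epsilon> \<le> \<bar>?W m j \<omega>\<bar>)"
  have [measurable]: "Measurable.pred M (bad \<epsilon> m)" for \<epsilon> m
    unfolding bad_def by measurable
  have "AE \<omega> in M. \<exists>m\<ge>1. \<not> bad \<epsilon> m \<omega>" if "0 < \<epsilon>" for \<epsilon>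
  proof -
    define p where "p = \<P>(\<omega> in M. \<forall>m\<ge>1. bad \<epsilon> m \<omega>)"
    have "p < r" if "0 < r" for r
    proof -
      have "0 < r * \<epsilon>^2 / 4" using that \<open>0 < \<epsilon>\<close> by simp
      from suminf_exist_split[OF this assms] obtain N
        where N: "\<And>n. N \<le> n \<Longrightarrow> norm (\<Sum>i. (w (i + n))^2) < r * \<epsilon>^2 / 4" by blast
      define m where "m = max N 1"
      have "p \<le> \<P>(\<omega> in M. bad \<epsilon> m \<omega>)"
        unfolding p_def by (rule finite_measure_mono) (auto simp: m_def)
      also have "\<dots> \<le> 4 * (\<Sum>k. (w (k + m))^2) / \<epsilon>^2"
        unfolding bad_def by (rule transform_tail_maximal_inequality) (use assms \<open>0 < \<epsilon>\<close> in \<open>auto simp: m_def\<close>)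
      also have "\<dots> < r" using N[of m] \<open>0 < \<epsilon>\<close> by (simp add: m_def field_simps)
      finally show ?thesis .
    qed
    then have "p = 0" unfolding p_def by (metis less_irrefl measure_nonneg order_less_le)
    then have "AE \<omega> in M. \<not> (\<forall>m\<ge>1. bad \<epsilon> m \<omega>)"
      unfolding p_def by (subst AE_iff_measurable[OF _ refl]) (simp_all add: emeasure_eq_measure)
    then show ?thesis by eventually_elim auto
  qed
  then have "AE \<omega> in M. \<forall>i::nat. \<exists>m\<ge>1. \<not> bad (1 / Suc i) m \<omega>"
    by (intro AE_all_countable[THEN iffD2] allI) simp
  then show ?thesis
  proof eventually_elim
    case (elim \<omega>)
    have "Cauchy (\<lambda>n. ?W 1 n \<omega>)"
    proof (rule CauchyI')
      fix e :: real assume "0 < e"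
      then obtain i where i: "1 / Suc i < e / 2" by (meson half_gt_zero nat_approx_posE)
      obtain m where "1 \<le> m" "\<not> bad (1 / Suc i) m \<omega>" using elim[rule_format, of i] by blast
      then have m: "1 \<le> m" "\<And>j. m \<le> j \<Longrightarrow> \<bar>?W m j \<omega>\<bar> < 1 / Suc i"
        unfolding bad_def by (auto simp: not_le[symmetric])
      have split: "?W 1 j \<omega> = ?W 1 m \<omega> + ?W m j \<omega>" if "m \<le> j" for j
        using m(1) that by (simp add: sum.atLeastLessThan_concat)
      show "\<exists>N. \<forall>j\<ge>N. \<forall>n>j. dist (?W 1 j \<omega>) (?W 1 n \<omega>) < e"
      proof (intro exI[of _ m] allI impI)
        fix j n assume "m \<le> j" "j < n"
        then show "dist (?W 1 j \<omega>) (?W 1 n \<omega>) < e"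
          using split[of j] split[of n] m(2)[of j] m(2)[of n] i unfolding dist_real_def by linarith
      qed
    qed
    then show ?case by (rule Cauchy_convergent)
  qed
qed

text \<open>The second moment obeys e (k+1) = (1 + 2 \<alpha> / k) e k + 1. Against C k powr (2
  \<beta>), the gap between \<alpha> and \<beta> leaves room for the constant 1, since k \<le> k
  powr (2 \<beta>), and Bernoulli's inequality bounds the growing factor.\<close>

lemma expectation_T_power2_le:
  assumes "1/2 \<le> \<beta>" "\<alpha> < \<beta>"
  obtains C where "1 \<le> C" "\<And>k. 1 \<le> k \<Longrightarrow> expectation (\<lambda>\<omega>. (T k \<omega>)^2) \<le> C * real k powr (2 * \<beta>)"
proof -
  define a where "a = max \<alpha> 0"
  have a: "0 \<le> a" "\<alpha> \<le> a" "a < \<beta>" using assms by (auto simp: a_def)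
  \<comment> \<open>The second entry of the maximum makes 2 C (\<beta> - a) \<ge> 1, which pays for
    the constant 1 in the recursion; the first covers k = 1.\<close>
  define C where "C = max 1 (1 / (2 * (\<beta> - a)))"
  have C: "1 \<le> C" "1 \<le> 2 * C * (\<beta> - a)"
    using a by (auto simp: C_def max_def field_simps)
  have "expectation (\<lambda>\<omega>. (T k \<omega>)^2) \<le> C * real k powr (2 * \<beta>)" if "1 \<le> k" for k
    using that
  proof (induction k rule: dec_induct)
    case base
    have "(T 1 \<omega>)^2 = 1" for \<omega> using step_values[of 1 \<omega>] by (auto simp: T_def)
    then show ?case using C by (simp add: prob_space)
  next
    case (step k)
    have k: "1 \<le> real k" using step by simp
    have "expectation (\<lambda>\<omega>. (T (Suc k) \<omega>)^2) = (1 + 2 * \<alpha> / k) * expectation (\<lambda>\<omega>. (T k \<omega>)^2) + 1"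
      using expectation_mult_T_power2[of k "\<lambda>_. 1"] step by (simp add: determined_by_const prob_space)
    also have "\<dots> \<le> (1 + 2 * a / k) * expectation (\<lambda>\<omega>. (T k \<omega>)^2) + 1"
      using a k by (intro add_right_mono mult_right_mono add_left_mono divide_right_mono) (auto simp: integral_nonneg)
    also have "\<dots> \<le> (1 + 2 * a / k) * (C * real k powr (2 * \<beta>)) + 1"
      using a step by (intro add_right_mono mult_left_mono) auto
    also have "\<dots> \<le> (1 + 2 * a / k) * (C * real k powr (2 * \<beta>)) + real k powr (2 * \<beta>) / k * (2 * C * (\<beta> - a))"
    proof (rule add_left_mono)
      have "real k powr 1 \<le> real k powr (2 * \<beta>)" using assms k by (intro powr_mono) auto
      then have "1 * 1 \<le> real k powr (2 * \<beta>) / k * (2 * C * (\<beta> - a))"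
        using C(2) k by (intro mult_mono) auto
      then show "1 \<le> real k powr (2 * \<beta>) / k * (2 * C * (\<beta> - a))" by simp
    qed
    also have "\<dots> = C * (real k powr (2 * \<beta>) * (1 + (2 * \<beta>) * (1 / k)))"
      using k by (simp add: field_simps)
    also have "\<dots> \<le> C * (real k powr (2 * \<beta>) * (1 + 1 / k) powr (2 * \<beta>))"
      using C assms by (intro mult_left_mono powr_ge_tangent) auto
    also have "\<dots> = C * (real k * (1 + 1 / k)) powr (2 * \<beta>)"
      by (subst powr_mult) auto
    also have "real k * (1 + 1 / k) = real (Suc k)" using k by (simp add: field_simps)
    finally show ?case .
  qed
  with that C show thesis by blast
qed

text \<open>The drift sum runs from 0 in order to be a partial sum of a series; its term at 0
  vanishes as T 0 = 0. The noise starts at 1 and the first step stands apart.\<close>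

lemma erw_poly_sum_Suc_eq:
  "erw_poly_sum Y \<gamma> (Suc n) \<omega> = Y 1 \<omega> + transform (\<lambda>k _. real (Suc k) powr (-\<gamma>)) 1 (Suc n) \<omega>
    + \<alpha> * (\<Sum>k<Suc n. real (Suc k) powr (-\<gamma>) * T k \<omega> / k)"
proof (induction n)
  case (Suc n)
  have "erw_poly_sum Y \<gamma> (Suc (Suc n)) \<omega> = erw_poly_sum Y \<gamma> (Suc n) \<omega>
      + (\<xi> (Suc n) \<omega> + \<alpha> * T (Suc n) \<omega> / Suc n) * real (Suc (Suc n)) powr (-\<gamma>)"
    by (simp add: erw_poly_sum_def \<xi>_def)
  with Suc show ?case by (simp add: algebra_simps)
qed (simp add: erw_poly_sum_def)

lemma poly_sum_convergent:
  assumes "1/2 < \<gamma>" "\<alpha> < \<gamma>"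
  shows "AE \<omega> in M. convergent (\<lambda>n. erw_poly_sum Y \<gamma> n \<omega>)"
proof -
  \<comment> \<open>An exponent strictly between max \<alpha> (1/2) and \<gamma>: the drift terms
    are then of order k powr (\<beta> - \<gamma> - 1) in mean, which is summable.\<close>
  define \<beta> where "\<beta> = (max \<alpha> (1/2) + \<gamma>) / 2"
  have \<beta>: "1/2 \<le> \<beta>" "\<alpha> < \<beta>" "\<beta> < \<gamma>" using assms by (auto simp: \<beta>_def max_def)
  obtain C where C: "1 \<le> C" "\<And>k. 1 \<le> k \<Longrightarrow> expectation (\<lambda>\<omega>. (T k \<omega>)^2) \<le> C * real k powr (2 * \<beta>)"
    using expectation_T_power2_le[OF \<beta>(1,2)] by blast
  have intT: "integrable M (T k)" "integrable M (\<lambda>\<omega>. (T k \<omega>)^2)" for k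
    by (intro determined_integrable[of k] adapted_intros determined_T; simp)+
  have ET: "expectation (\<lambda>\<omega>. \<bar>T k \<omega>\<bar>) \<le> C * real k powr \<beta>" if k: "1 \<le> k" for k
  proof -
    define r where "r = real k powr \<beta>"
    have r: "0 < r" "r^2 = real k powr (2 * \<beta>)"
      using k by (auto simp: r_def power2_eq_square simp flip: powr_add)
    \<comment> \<open>The arithmetic-geometric mean inequality, scaled by the expected order r of
      the walk, takes the place of Cauchy-Schwarz.\<close>
    have "\<bar>T k \<omega>\<bar> \<le> r / 2 + (T k \<omega>)^2 / (2 * r)" for \<omega>
    proof -
      have "2 * \<bar>T k \<omega>\<bar> * r \<le> (T k \<omega>)^2 + r^2"
        using sum_squares_bound[of "\<bar>T k \<omega>\<bar>" r] by simp
      then show ?thesis using r(1) by (simp add: field_simps power2_eq_square)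
    qed
    then have "expectation (\<lambda>\<omega>. \<bar>T k \<omega>\<bar>) \<le> expectation (\<lambda>\<omega>. r / 2 + (T k \<omega>)^2 / (2 * r))"
      using intT by (intro integral_mono) auto
    also have "\<dots> = r / 2 + expectation (\<lambda>\<omega>. (T k \<omega>)^2) / (2 * r)"
      using intT by (simp add: prob_space)
    also have "\<dots> \<le> r / 2 + C * r^2 / (2 * r)"
      using C(2)[OF k] r by (intro add_left_mono divide_right_mono) auto
    also have "\<dots> = (r + C * r) / 2" using r(1) by (simp add: power2_eq_square field_simps)
    also have "\<dots> \<le> C * r" using r(1) C(1) by simp
    finally show ?thesis by (simp add: r_def)
  qed
  have "AE \<omega> in M. summable (\<lambda>k. real (Suc k) powr (-\<gamma>) * T k \<omega> / k)"
  proof (rule AE_summable_if_summable_expectation)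
    have bound: "expectation (\<lambda>\<omega>. \<bar>real (Suc k) powr (-\<gamma>) * T k \<omega> / k\<bar>) \<le> C * real k powr (\<beta> - \<gamma> - 1)"
      if k: "1 \<le> k" for k
    proof -
      have "expectation (\<lambda>\<omega>. \<bar>real (Suc k) powr (-\<gamma>) * T k \<omega> / k\<bar>)
          = real (Suc k) powr (-\<gamma>) / k * expectation (\<lambda>\<omega>. \<bar>T k \<omega>\<bar>)"
        by (simp add: abs_mult)
      also have "\<dots> \<le> real k powr (-\<gamma>) / k * (C * real k powr \<beta>)"
        using k assms ET[OF k] by (intro mult_mono divide_right_mono powr_mono2') auto
      also have "\<dots> = C * real k powr (\<beta> - \<gamma> - 1)"
        using k by (simp add: powr_diff powr_minus powr_add field_simps)
      finally show ?thesis .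
    qed
    have "summable (\<lambda>k. C * real k powr (\<beta> - \<gamma> - 1))"
      using \<beta> by (intro summable_mult) (simp add: summable_real_powr_iff)
    then show "summable (\<lambda>k. expectation (\<lambda>\<omega>. \<bar>real (Suc k) powr (-\<gamma>) * T k \<omega> / k\<bar>))"
      by (rule summable_comparison_test'[where N = 1]) (use bound in \<open>simp add: integral_nonneg\<close>)
  qed (use intT in simp)
  moreover have "AE \<omega> in M. convergent (\<lambda>n. transform (\<lambda>k _. real (Suc k) powr (-\<gamma>)) 1 n \<omega>)"
  proof (rule transform_convergent)
    have "summable (\<lambda>k. real k powr (-2 * \<gamma>))"
      using assms by (simp add: summable_real_powr_iff)
    then have "summable (\<lambda>k. real (Suc k) powr (-2 * \<gamma>))" by (subst summable_Suc_iff)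
    then show "summable (\<lambda>k. (real (Suc k) powr (-\<gamma>))^2)"
      by (simp add: power2_eq_square flip: powr_add)
  qed
  ultimately show ?thesis
  proof eventually_elim
    case (elim \<omega>)
    have "convergent (\<lambda>n. \<Sum>k<n. real (Suc k) powr (-\<gamma>) * T k \<omega> / k)"
      using elim(1) by (simp add: summable_iff_convergent)
    then have "convergent (\<lambda>n. Y 1 \<omega> + transform (\<lambda>k _. real (Suc k) powr (-\<gamma>)) 1 (Suc n) \<omega>
        + \<alpha> * (\<Sum>k<Suc n. real (Suc k) powr (-\<gamma>) * T k \<omega> / k))"
      using elim(2)
      by (intro convergent_add convergent_const convergent_mult
          convergent_Suc_iff[THEN iffD2, of "\<lambda>n. transform _ _ n _"]
          convergent_Suc_iff[THEN iffD2, of "\<lambda>n. (\<Sum>k<n. _ k)"])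
    then show ?case
      unfolding erw_poly_sum_Suc_eq[symmetric] by (subst (asm) convergent_Suc_iff)
  qed
qed

end

section \<open>Divergence in the superdiffusive regime\<close>

text \<open>For n \<ge> 1 and \<alpha> > -1 this is Gamma (n + \<alpha>) / (Gamma (1 + \<alpha>)
  Gamma n), hence of order n powr \<alpha>. The conditional mean of T (n+1) is (1 + \<alpha> / n) T
  n, so dividing by it gives a martingale.\<close>

definition growth :: "real \<Rightarrow> nat \<Rightarrow> real" where
  "growth \<alpha> n = (\<Prod>k\<in>{1..<n}. 1 + \<alpha> / real k)"

lemma growth_Suc: "1 \<le> n \<Longrightarrow> growth \<alpha> (Suc n) = growth \<alpha> n * (1 + \<alpha> / n)"
  by (simp add: growth_def)

text \<open>Factor by factor, by concavity of the power.\<close>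

lemma growth_ge:
  assumes "0 \<le> \<alpha>" "\<alpha> \<le> 1" "1 \<le> n"
  shows "real n powr \<alpha> \<le> growth \<alpha> n"
  using assms(3)
proof (induction n rule: dec_induct)
  case base
  then show ?case by (simp add: growth_def)
next
  case (step n)
  have n: "1 \<le> real n" using step by simp
  have "real (Suc n) powr \<alpha> = real n powr \<alpha> * (real (Suc n) / n) powr \<alpha>"
    using n by (simp add: powr_mult[symmetric])
  also have "(real (Suc n) / n) powr \<alpha> \<le> 1 + \<alpha> * (real (Suc n) / n - 1)"
    using assms n by (intro powr_le_tangent) auto
  also have "1 + \<alpha> * (real (Suc n) / n - 1) = 1 + \<alpha> / n" using n by (simp add: field_simps)
  also have "real n powr \<alpha> * (1 + \<alpha> / n) \<le> growth \<alpha> (Suc n)"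
    using step assms by (simp add: growth_Suc mult_right_mono)
  finally show ?case by (simp add: mult_left_mono)
qed

lemma growth_pos: "0 \<le> \<alpha> \<Longrightarrow> 0 < growth \<alpha> n"
  unfolding growth_def by (intro prod_pos) (auto intro: add_pos_nonneg)

lemma growth_one: "1 \<le> n \<Longrightarrow> growth 1 n = n"
  by (induction n rule: dec_induct) (auto simp: growth_Suc field_simps, simp add: growth_def)

lemma summable_inverse_growth_power2:
  assumes "1/2 < \<alpha>" "\<alpha> \<le> 1"
  shows "summable (\<lambda>k. (1 / growth \<alpha> (Suc k))^2)"
proof (rule summable_comparison_test')
  have "summable (\<lambda>k. real k powr (-2 * \<alpha>))" using assms by (simp add: summable_real_powr_iff)
  then show "summable (\<lambda>k. real (Suc k) powr (-2 * \<alpha>))" by (subst summable_Suc_iff)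
  fix k :: nat
  have "1 / growth \<alpha> (Suc k) \<le> 1 / real (Suc k) powr \<alpha>"
    using growth_ge[of \<alpha> "Suc k"] growth_pos[of \<alpha> "Suc k"] assms by (intro divide_left_mono) auto
  then have "(1 / growth \<alpha> (Suc k))^2 \<le> (1 / real (Suc k) powr \<alpha>)^2"
    using growth_pos[of \<alpha> "Suc k"] assms by (intro power_mono) auto
  also have "\<dots> = real (Suc k) powr (-2 * \<alpha>)"
    by (simp add: power2_eq_square powr_minus_divide flip: powr_add)
  finally show "norm ((1 / growth \<alpha> (Suc k))^2) \<le> real (Suc k) powr (-2 * \<alpha>)" by simp
qed

lemma erw_poly_sum_by_parts:
  assumes "1 \<le> n"
  shows "erw_poly_sum X \<gamma> n \<omega> = real n powr (-\<gamma>) * (\<Sum>j=1..n. X j \<omega>)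
    + (\<Sum>k=1..<n. (real k powr (-\<gamma>) - real (Suc k) powr (-\<gamma>)) * (\<Sum>j=1..k. X j \<omega>))"
  using assms
  by (induction n rule: dec_induct) (simp_all add: erw_poly_sum_def algebra_simps)

text \<open>A pathwise statement. Eventually the walk is at least (L / 2) n powr \<gamma>; after
  summation by parts the differences of powers are of order k powr (-\<gamma> - 1), so the terms
  dominate a multiple of the harmonic series.\<close>

lemma erw_poly_sum_at_top:
  assumes \<gamma>: "0 < \<gamma>" "\<gamma> \<le> \<alpha>" "\<alpha> \<le> 1"
    and lim: "(\<lambda>n. (\<Sum>j=1..n. X j \<omega>) / growth \<alpha> n) \<longlonglongrightarrow> L" and "0 < L"
  shows "filterlim (\<lambda>n. erw_poly_sum X \<gamma> n \<omega>) at_top sequentially"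
proof -
  define t where "t = (\<lambda>n. \<Sum>j=1..n. X j \<omega>)"
  define d where "d = (\<lambda>k. (real k powr (-\<gamma>) - real (Suc k) powr (-\<gamma>)) * t k)"
  have "eventually (\<lambda>n. L / 2 < t n / growth \<alpha> n) sequentially"
    using order_tendstoD(1)[OF lim, of "L / 2"] \<open>0 < L\<close> by (simp add: t_def)
  then obtain N' where N': "\<And>n. N' \<le> n \<Longrightarrow> L / 2 < t n / growth \<alpha> n"
    by (auto simp: eventually_sequentially)
  define N where "N = max N' 1"
  have t: "L / 2 * real n powr \<gamma> \<le> t n" if "N \<le> n" for n
  proof -
    have n: "N' \<le> n" "1 \<le> n" using that by (auto simp: N_def)
    have "real n powr \<gamma> \<le> real n powr \<alpha>" using \<gamma> n by (intro powr_mono) auto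
    also have "\<dots> \<le> growth \<alpha> n" using \<gamma> n by (intro growth_ge) auto
    finally have "L / 2 * real n powr \<gamma> \<le> L / 2 * growth \<alpha> n" using \<open>0 < L\<close> by simp
    also have "\<dots> \<le> t n" using N'[OF n(1)] growth_pos[of \<alpha> n] \<gamma> by (simp add: pos_less_divide_eq)
    finally show ?thesis .
  qed
  have d: "\<gamma> * L / 4 * (1 / real (Suc k)) \<le> d k" if "N \<le> k" for k
  proof -
    have k: "1 \<le> k" "1 \<le> real k" using that by (auto simp: N_def)
    \<comment> \<open>As \<gamma> \<le> 1 and the base is below 1, the power is at least the base
      itself.\<close>
    have "real k / real (Suc k) = (real k / real (Suc k)) powr 1" using k by simp
    also have "\<dots> \<le> (real k / real (Suc k)) powr \<gamma>"
      using k \<gamma> by (intro powr_mono') auto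
    also have "\<dots> = real (Suc k) powr (-\<gamma>) * real k powr \<gamma>"
      using k by (subst powr_divide) (simp_all add: powr_minus_divide)
    finally have r: "real k / real (Suc k) \<le> real (Suc k) powr (-\<gamma>) * real k powr \<gamma>" .
    have "\<gamma> * L / 4 * (1 / real (Suc k)) = \<gamma> / (2 * k) * (L / 2) * (real k / real (Suc k))"
      using k by (simp del: of_nat_Suc)
    also have "\<dots> \<le> \<gamma> / (2 * k) * (L / 2) * (real (Suc k) powr (-\<gamma>) * real k powr \<gamma>)"
      using r \<gamma> \<open>0 < L\<close> by (intro mult_left_mono) auto
    also have "\<dots> = (\<gamma> / (2 * k) * real (Suc k) powr (-\<gamma>)) * (L / 2 * real k powr \<gamma>)" by simp
    also have "\<dots> \<le> (real k powr (-\<gamma>) - real (Suc k) powr (-\<gamma>)) * t k"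
    proof (rule mult_mono[OF _ t[OF that]])
      show "\<gamma> / (2 * k) * real (Suc k) powr (-\<gamma>) \<le> real k powr (-\<gamma>) - real (Suc k) powr (-\<gamma>)"
        using powr_neg_ratio_ge[of \<gamma> k] \<gamma> k by (simp add: algebra_simps)
      show "0 \<le> real k powr (-\<gamma>) - real (Suc k) powr (-\<gamma>)"
        using \<gamma> k by (simp add: powr_mono2')
      show "0 \<le> L / 2 * real k powr \<gamma>" using \<open>0 < L\<close> by simp
    qed
    finally show ?thesis by (simp add: d_def)
  qed
  have "filterlim (\<lambda>n. sum d {1..<N} + \<gamma> * L / 4 * (\<Sum>k=N..<n. 1 / real (Suc k))) at_top sequentially"
    using \<gamma> \<open>0 < L\<close>
    by (intro filterlim_tendsto_add_at_top[OF tendsto_const]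
        filterlim_tendsto_pos_mult_at_top[OF tendsto_const _ filterlim_sum_inverse]) auto
  moreover have "eventually (\<lambda>n. sum d {1..<N} + \<gamma> * L / 4 * (\<Sum>k=N..<n. 1 / real (Suc k))
      \<le> erw_poly_sum X \<gamma> n \<omega>) sequentially"
    using eventually_ge_at_top[of N]
  proof eventually_elim
    case (elim n)
    have "0 \<le> L / 2 * real n powr \<gamma>" using \<open>0 < L\<close> by simp
    then have "0 \<le> real n powr (-\<gamma>) * t n" using t[OF elim] by (intro mult_nonneg_nonneg) auto
    moreover have "sum d {1..<n} = sum d {1..<N} + sum d {N..<n}"
      using elim by (simp add: N_def sum.atLeastLessThan_concat)
    moreover have "\<gamma> * L / 4 * (\<Sum>k=N..<n. 1 / real (Suc k)) \<le> sum d {N..<n}"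
      unfolding sum_distrib_left using d by (intro sum_mono) auto
    moreover have "erw_poly_sum X \<gamma> n \<omega> = real n powr (-\<gamma>) * t n + sum d {1..<n}"
      using elim by (simp add: erw_poly_sum_by_parts N_def t_def d_def)
    ultimately show ?case by linarith
  qed
  ultimately show ?thesis by (rule filterlim_at_top_mono)
qed

section \<open>The normalised walk and its nonzero limit\<close>

context step_process begin

lemma T_over_growth_eq:
  assumes "0 \<le> \<alpha>" "1 \<le> m" "m \<le> n"
  shows "T n \<omega> / growth \<alpha> n = T m \<omega> / growth \<alpha> m + transform (\<lambda>k _. 1 / growth \<alpha> (Suc k)) m n \<omega>"
  using assms(3)
proof (induction n rule: dec_induct)
  case (step n)
  have n: "1 \<le> n" using step assms by simp
  have "0 < 1 + \<alpha> / n" using assms by (simp add: add_pos_nonneg)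
  then have "(1 + \<alpha> / n) * T n \<omega> / growth \<alpha> (Suc n) = T n \<omega> / growth \<alpha> n"
    unfolding growth_Suc[OF n] by simp
  moreover have "T (Suc n) \<omega> = (1 + \<alpha> / n) * T n \<omega> + \<xi> n \<omega>"
    by (simp add: T_Suc \<xi>_def algebra_simps)
  ultimately have "T (Suc n) \<omega> / growth \<alpha> (Suc n) = T n \<omega> / growth \<alpha> n + \<xi> n \<omega> / growth \<alpha> (Suc n)"
    by (simp add: add_divide_distrib)
  with step show ?case by simp
qed simp

lemma determined_T_over_growth: "n \<le> m \<Longrightarrow> adapted m (\<lambda>\<omega>. T n \<omega> / growth \<alpha> n)"
  by (intro determined_by_map[where F = "\<lambda>x. x / growth \<alpha> n"] determined_T)

lemma T_over_growth_convergent: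
  assumes "1/2 < \<alpha>"
  shows "AE \<omega> in M. convergent (\<lambda>n. T n \<omega> / growth \<alpha> n)"
proof -
  have "AE \<omega> in M. convergent (\<lambda>n. transform (\<lambda>k _. 1 / growth \<alpha> (Suc k)) 1 n \<omega>)"
    using assms alpha_bounds by (intro transform_convergent summable_inverse_growth_power2)
  then show ?thesis
  proof eventually_elim
    case (elim \<omega>)
    then have "convergent (\<lambda>n. T 1 \<omega> / growth \<alpha> 1 + transform (\<lambda>k _. 1 / growth \<alpha> (Suc k)) 1 n \<omega>)"
      by (intro convergent_add convergent_const)
    moreover have "eventually (\<lambda>n. T 1 \<omega> / growth \<alpha> 1 + transform (\<lambda>k _. 1 / growth \<alpha> (Suc k)) 1 n \<omega>
        = T n \<omega> / growth \<alpha> n) sequentially"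
      using eventually_ge_at_top[of 1] by eventually_elim (rule T_over_growth_eq[symmetric], use assms in auto)
    ultimately show ?case by (simp only: convergent_cong)
  qed
qed

text \<open>\<open>Q\<close> is split by the sign of the normalised walk at m. On each half the
  noise pushes further in the same direction with conditional probability at least c, negated
  weights serving the negative half, so the starting value cannot cancel it.\<close>

lemma T_over_growth_escape:
  assumes "1/2 < \<alpha>" "\<alpha> < 1"
  obtains c where "0 < c"
    and "\<And>m Q. 1 \<le> m \<Longrightarrow> adapted m Q \<Longrightarrow> \<exists>\<rho>>0. \<forall>n>m.
      c * \<P>(\<omega> in M. Q \<omega>) \<le> \<P>(\<omega> in M. Q \<omega> \<and> \<rho> \<le> \<bar>T n \<omega> / growth \<alpha> n\<bar>)"
proof -
  \<comment> \<open>A lower bound for the conditional noise variance 1 - (\<alpha> T k / k)^2,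
    positive because \<alpha> < 1.\<close>
  define \<delta> where "\<delta> = 1 - \<alpha>^2"
  have "\<alpha>^2 < 1^2" using assms by (intro power_strict_mono) auto
  then have \<delta>: "0 < \<delta>" "\<delta> \<le> 1" by (auto simp: \<delta>_def)
  obtain \<epsilon> c :: real where "0 < \<epsilon>" "0 < c"
    and pz: "\<And>m n w Q. 1 \<le> m \<Longrightarrow> adapted m Q \<Longrightarrow> 0 < (\<Sum>k=m..<n. (w k)^2) \<Longrightarrow>
      (\<And>k. m \<le> k \<Longrightarrow> \<delta> * \<P>(\<omega> in M. Q \<omega>) \<le> expectation (\<lambda>\<omega>. of_bool (Q \<omega>) * (\<xi> k \<omega>)^2)) \<Longrightarrow>
      c * \<P>(\<omega> in M. Q \<omega>)
        \<le> \<P>(\<omega> in M. Q \<omega> \<and> \<epsilon> * sqrt (\<Sum>k=m..<n. (w k)^2) \<le> transform (\<lambda>k _. w k) m n \<omega>)"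
    by (rule transform_paley_zygmund[OF \<delta>]) auto
  have noise: "\<delta> * \<P>(\<omega> in M. Q \<omega>) \<le> expectation (\<lambda>\<omega>. of_bool (Q \<omega>) * (\<xi> k \<omega>)^2)"
    if "1 \<le> m" "adapted m Q" "m \<le> k" for m k Q
  proof -
    define Z :: "'a \<Rightarrow> real" where "Z = (\<lambda>\<omega>. of_bool (Q \<omega>))"
    have Z: "adapted k Z" unfolding Z_def by (rule determined_by_map[OF determined_by_mono[OF that(2,3)]])
    have int: "integrable M Z" "integrable M (\<lambda>\<omega>. Z \<omega> * (T k \<omega>)^2)"
      by (intro determined_integrable[of k] adapted_intros Z determined_T; simp)+
    have "(\<alpha> / k)^2 * (Z \<omega> * (T k \<omega>)^2) \<le> \<alpha>^2 * Z \<omega>" for \<omega>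
    proof -
      have "(T k \<omega>)^2 \<le> real k^2" using power_mono[OF abs_T_le[of k \<omega>], of 2] by simp
      then have "(T k \<omega>)^2 / real k^2 \<le> 1" using that by (simp add: divide_le_eq)
      from mult_left_mono[OF this, of "\<alpha>^2 * Z \<omega>"] show ?thesis
        by (simp add: Z_def power_divide mult_ac)
    qed
    then have "expectation (\<lambda>\<omega>. (\<alpha> / k)^2 * (Z \<omega> * (T k \<omega>)^2)) \<le> expectation (\<lambda>\<omega>. \<alpha>^2 * Z \<omega>)"
      using int by (intro integral_mono) auto
    then have "(\<alpha> / k)^2 * expectation (\<lambda>\<omega>. Z \<omega> * (T k \<omega>)^2) \<le> \<alpha>^2 * expectation Z" by simp
    then have "\<delta> * expectation Z \<le> expectation (\<lambda>\<omega>. Z \<omega> * (\<xi> k \<omega>)^2)"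
      using expectation_mult_noise_power2[of k Z] Z that by (simp add: \<delta>_def left_diff_distrib)
    then show ?thesis
      using expectation_of_bool[of Q] determined_event[OF that(2)] by (simp add: Z_def)
  qed
  have "\<exists>\<rho>>0. \<forall>n>m. c * \<P>(\<omega> in M. Q \<omega>) \<le> \<P>(\<omega> in M. Q \<omega> \<and> \<rho> \<le> \<bar>T n \<omega> / growth \<alpha> n\<bar>)"
    if m: "1 \<le> m" and Q: "adapted m Q" for m Q
  proof -
    define w where "w = (\<lambda>k. 1 / growth \<alpha> (Suc k))"
    define R where "R = (\<lambda>n \<omega>. T n \<omega> / growth \<alpha> n)"
    have w: "0 < w k" for k using growth_pos[of \<alpha> "Suc k"] assms by (simp add: w_def)
    \<comment> \<open>The first term alone bounds the sum of squares from below, which makes \<rho>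
      independent of n.\<close>
    define \<rho> where "\<rho> = \<epsilon> * w m"
    have "c * \<P>(\<omega> in M. Q \<omega>) \<le> \<P>(\<omega> in M. Q \<omega> \<and> \<rho> \<le> \<bar>R n \<omega>\<bar>)" if n: "m < n" for n
    proof -
      let ?V = "\<Sum>k=m..<n. (w k)^2"
      have Vge: "(w m)^2 \<le> ?V" using n by (intro member_le_sum) auto
      have V: "0 < ?V" using Vge w[of m] by (smt (verit) zero_less_power)
      have "w m \<le> sqrt ?V" using Vge by (rule real_le_rsqrt)
      then have \<rho>: "\<rho> \<le> \<epsilon> * sqrt ?V" using \<open>0 < \<epsilon>\<close> by (simp add: \<rho>_def)
      have R: "R n \<omega> = R m \<omega> + transform (\<lambda>k _. w k) m n \<omega>" for \<omega>
        unfolding R_def w_def using T_over_growth_eq[of m n \<omega>] m n assms by simp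
      define Qp where "Qp = (\<lambda>\<omega>. Q \<omega> \<and> 0 \<le> R m \<omega>)"
      define Qn where "Qn = (\<lambda>\<omega>. Q \<omega> \<and> \<not> 0 \<le> R m \<omega>)"
      have Rm: "adapted k (R k)" for k unfolding R_def by (rule determined_T_over_growth) simp
      have Qp: "adapted m Qp" and Qn: "adapted m Qn"
        unfolding Qp_def Qn_def
        by (intro determined_by_map2[OF Q Rm, where F = "\<lambda>a b. a \<and> 0 \<le> b"]
            determined_by_map2[OF Q Rm, where F = "\<lambda>a b. a \<and> \<not> 0 \<le> b"])+
      have RnQ: "adapted n (\<lambda>\<omega>. F (Q \<omega>) (R m \<omega>) (R n \<omega>))" for F :: "bool \<Rightarrow> real \<Rightarrow> real \<Rightarrow> bool"
        by (intro determined_by_map2[of Y n "\<lambda>\<omega>. F (Q \<omega>) (R m \<omega>)" "R n" "\<lambda>f x. f x"]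
            determined_by_map2[of Y n Q "R m" F] Rm determined_by_mono[OF Q] determined_by_mono[OF Rm])
           (use n in auto)
      have "c * \<P>(\<omega> in M. Qp \<omega>)
          \<le> \<P>(\<omega> in M. Qp \<omega> \<and> \<epsilon> * sqrt ?V \<le> transform (\<lambda>k _. w k) m n \<omega>)"
        by (intro pz[OF m Qp V] noise[OF m Qp])
      also have "\<dots> \<le> \<P>(\<omega> in M. Qp \<omega> \<and> \<rho> \<le> \<bar>R n \<omega>\<bar>)"
      proof (rule finite_measure_mono)
        show "{\<omega>\<in>space M. Qp \<omega> \<and> \<rho> \<le> \<bar>R n \<omega>\<bar>} \<in> events"
          unfolding Qp_def using RnQ[of "\<lambda>q x y. (q \<and> 0 \<le> x) \<and> \<rho> \<le> \<bar>y\<bar>"] by (rule determined_event)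
      qed (use \<rho> in \<open>auto simp: Qp_def R\<close>)
      finally have p: "c * \<P>(\<omega> in M. Qp \<omega>) \<le> \<P>(\<omega> in M. Qp \<omega> \<and> \<rho> \<le> \<bar>R n \<omega>\<bar>)" .
      have "c * \<P>(\<omega> in M. Qn \<omega>)
          \<le> \<P>(\<omega> in M. Qn \<omega> \<and> \<epsilon> * sqrt (\<Sum>k=m..<n. (- w k)^2) \<le> transform (\<lambda>k _. - w k) m n \<omega>)"
        using V by (intro pz[OF m Qn] noise[OF m Qn]) simp
      also have "\<dots> \<le> \<P>(\<omega> in M. Qn \<omega> \<and> \<rho> \<le> \<bar>R n \<omega>\<bar>)"
      proof (rule finite_measure_mono)
        show "{\<omega>\<in>space M. Qn \<omega> \<and> \<rho> \<le> \<bar>R n \<omega>\<bar>} \<in> events"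
          unfolding Qn_def using RnQ[of "\<lambda>q x y. (q \<and> \<not> 0 \<le> x) \<and> \<rho> \<le> \<bar>y\<bar>"] by (rule determined_event)
      qed (use \<rho> in \<open>auto simp: Qn_def R sum_negf\<close>)
      finally have q: "c * \<P>(\<omega> in M. Qn \<omega>) \<le> \<P>(\<omega> in M. Qn \<omega> \<and> \<rho> \<le> \<bar>R n \<omega>\<bar>)" .
      have split1: "\<P>(\<omega> in M. Q \<omega>) = \<P>(\<omega> in M. Qp \<omega>) + \<P>(\<omega> in M. Qn \<omega>)"
        using determined_event[OF Qp] determined_event[OF Qn]
        by (subst finite_measure_Union[symmetric]) (auto simp: Qp_def Qn_def intro!: arg_cong[where f = prob])
      have split2: "\<P>(\<omega> in M. Q \<omega> \<and> \<rho> \<le> \<bar>R n \<omega>\<bar>)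
          = \<P>(\<omega> in M. Qp \<omega> \<and> \<rho> \<le> \<bar>R n \<omega>\<bar>) + \<P>(\<omega> in M. Qn \<omega> \<and> \<rho> \<le> \<bar>R n \<omega>\<bar>)"
        using determined_event[OF RnQ[of "\<lambda>q x y. (q \<and> 0 \<le> x) \<and> \<rho> \<le> \<bar>y\<bar>"]]
          determined_event[OF RnQ[of "\<lambda>q x y. (q \<and> \<not> 0 \<le> x) \<and> \<rho> \<le> \<bar>y\<bar>"]]
        by (subst finite_measure_Union[symmetric]) (auto simp: Qp_def Qn_def intro!: arg_cong[where f = prob])
      show ?thesis unfolding split1 split2 using p q by (simp add: algebra_simps)
    qed
    moreover have "0 < \<rho>" using \<open>0 < \<epsilon>\<close> w by (simp add: \<rho>_def)
    ultimately show ?thesis unfolding R_def by blast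
  qed
  with \<open>0 < c\<close> that show thesis by blast
qed

text \<open>The event that the limit vanishes is approximated by \<open>Q m\<close>, which depends on the first \<open>m\<close>
  steps only; given \<open>Q m\<close>, the limit is nonzero with probability at least \<open>c\<close>.\<close>

lemma T_over_growth_limit_nonzero_less_one:
  assumes "1/2 < \<alpha>" "\<alpha> < 1"
  shows "AE \<omega> in M. \<not> (\<lambda>n. T n \<omega> / growth \<alpha> n) \<longlonglongrightarrow> 0"
proof -
  define w where "w = (\<lambda>k. 1 / growth \<alpha> (Suc k))"
  define R where "R = (\<lambda>n \<omega>. T n \<omega> / growth \<alpha> n)"
  define v where "v = (\<lambda>m. \<Sum>k. (w (k + m))^2)"
  \<comment> \<open>The fourth root of the tail variance tends to 0, yet slowly enough that v m /
    (\<eta> m)^2 = sqrt (v m) tends to 0 as well.\<close>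
  define \<eta> where "\<eta> = (\<lambda>m. sqrt (sqrt (v m)))"
  define Q where "Q = (\<lambda>m \<omega>. \<bar>R m \<omega>\<bar> \<le> \<eta> m)"
  \<comment> \<open>Convergence to 0 in terms of countable quantifiers, from which measurability is
    immediate.\<close>
  define Null where "Null = (\<lambda>\<omega>. \<forall>i::nat. \<exists>N. \<forall>n\<ge>N. \<bar>R n \<omega>\<bar> < 1 / Suc i)"
  obtain c where "0 < c"
    and escape: "\<And>m Q. 1 \<le> m \<Longrightarrow> adapted m Q \<Longrightarrow> \<exists>\<rho>>0. \<forall>n>m.
      c * \<P>(\<omega> in M. Q \<omega>) \<le> \<P>(\<omega> in M. Q \<omega> \<and> \<rho> \<le> \<bar>R n \<omega>\<bar>)"
    unfolding R_def by (rule T_over_growth_escape[OF assms]) auto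
  have w: "summable (\<lambda>k. (w k)^2)" "\<And>k. 0 < w k"
    unfolding w_def using summable_inverse_growth_power2[of \<alpha>] growth_pos assms by auto
  have v_pos: "0 < v m" for m
    unfolding v_def using w(1) by (intro suminf_pos summable_ignore_initial_segment zero_less_power w(2))
  have v_lim: "v \<longlonglongrightarrow> 0"
  proof (rule LIMSEQ_I)
    fix r :: real assume "0 < r"
    from suminf_exist_split[OF this w(1)] show "\<exists>N. \<forall>n\<ge>N. norm (v n - 0) < r" by (simp add: v_def)
  qed
  have \<eta>_lim: "\<eta> \<longlonglongrightarrow> 0"
    using tendsto_real_sqrt[OF tendsto_real_sqrt[OF v_lim]] by (simp add: \<eta>_def)
  have R_det: "adapted n (R n)" for n unfolding R_def by (rule determined_T_over_growth) simp
  have [measurable]: "R n \<in> borel_measurable M" for n using R_det by blast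
  have [measurable]: "Measurable.pred M (Q m)" "Measurable.pred M Null" for m
    unfolding Q_def Null_def by measurable
  have Q: "adapted m (Q m)" for m
    unfolding Q_def by (rule determined_by_map[OF R_det, where F = "\<lambda>x. \<bar>x\<bar> \<le> \<eta> m"])
  have Null_iff: "Null \<omega> \<longleftrightarrow> (\<lambda>n. R n \<omega>) \<longlonglongrightarrow> 0" for \<omega>
  proof
    assume null: "Null \<omega>"
    show "(\<lambda>n. R n \<omega>) \<longlonglongrightarrow> 0"
    proof (rule LIMSEQ_I)
      fix r :: real assume "0 < r"
      then obtain i where "1 / Suc i < r" using nat_approx_posE by blast
      then show "\<exists>N. \<forall>n\<ge>N. norm (R n \<omega> - 0) < r"
        using null unfolding Null_def by (metis diff_zero less_trans real_norm_def)
    qed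
  next
    assume "(\<lambda>n. R n \<omega>) \<longlonglongrightarrow> 0"
    then show "Null \<omega>" unfolding Null_def LIMSEQ_iff by simp
  qed
  \<comment> \<open>Where the limit is nonzero, \<open>Q m\<close> fails for large m because \<eta>
    m tends to 0.\<close>
  have "AE \<omega> in M. eventually (\<lambda>m. \<not> (Q m \<omega> \<and> \<not> Null \<omega>)) sequentially"
    using T_over_growth_convergent[OF assms(1)]
  proof eventually_elim
    case (elim \<omega>)
    then obtain L where L: "(\<lambda>n. R n \<omega>) \<longlonglongrightarrow> L" by (auto simp: R_def convergent_def)
    show ?case
    proof (cases "L = 0")
      case False
      have "eventually (\<lambda>m. \<eta> m < \<bar>L\<bar> / 2) sequentially" "eventually (\<lambda>m. \<bar>L\<bar> / 2 < \<bar>R m \<omega>\<bar>) sequentially"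
        using order_tendstoD(2)[OF \<eta>_lim, of "\<bar>L\<bar> / 2"] order_tendstoD(1)[OF tendsto_rabs[OF L], of "\<bar>L\<bar> / 2"]
          False by auto
      then show ?thesis by eventually_elim (auto simp: Q_def)
    qed (use L Null_iff in simp)
  qed
  then have lim1: "(\<lambda>m. \<P>(\<omega> in M. Q m \<omega> \<and> \<not> Null \<omega>)) \<longlonglongrightarrow> 0"
    by (intro prob_tendsto_0) auto
  \<comment> \<open>With m fixed and n growing, the normalised walk drops below \<rho> on
    \<open>Null\<close>, so in the limit the escape takes place outside \<open>Null\<close>.\<close>
  have le1: "c * \<P>(\<omega> in M. Q m \<omega>) \<le> \<P>(\<omega> in M. Q m \<omega> \<and> \<not> Null \<omega>)" if m: "1 \<le> m" for m
  proof -
    obtain \<rho> where \<rho>: "0 < \<rho>" "\<And>n. m < n \<Longrightarrow> c * \<P>(\<omega> in M. Q m \<omega>) \<le> \<P>(\<omega> in M. Q m \<omega> \<and> \<rho> \<le> \<bar>R n \<omega>\<bar>)"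
      using escape[OF m Q] by blast
    have "(\<lambda>n. \<P>(\<omega> in M. Null \<omega> \<and> \<rho> \<le> \<bar>R n \<omega>\<bar>)) \<longlonglongrightarrow> 0"
    proof (rule prob_tendsto_0)
      show "AE \<omega> in M. eventually (\<lambda>n. \<not> (Null \<omega> \<and> \<rho> \<le> \<bar>R n \<omega>\<bar>)) sequentially"
      proof (rule AE_I2)
        fix \<omega>
        show "eventually (\<lambda>n. \<not> (Null \<omega> \<and> \<rho> \<le> \<bar>R n \<omega>\<bar>)) sequentially"
        proof (cases "Null \<omega>")
          case True
          then have "(\<lambda>n. \<bar>R n \<omega>\<bar>) \<longlonglongrightarrow> 0" using Null_iff tendsto_rabs_zero by blast
          from order_tendstoD(2)[OF this \<rho>(1)] show ?thesis by eventually_elim auto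
        qed simp
      qed
    qed simp
    then have "(\<lambda>n. \<P>(\<omega> in M. Q m \<omega> \<and> \<not> Null \<omega>) + \<P>(\<omega> in M. Null \<omega> \<and> \<rho> \<le> \<bar>R n \<omega>\<bar>))
        \<longlonglongrightarrow> \<P>(\<omega> in M. Q m \<omega> \<and> \<not> Null \<omega>) + 0"
      by (intro tendsto_add tendsto_const)
    moreover have "c * \<P>(\<omega> in M. Q m \<omega>)
        \<le> \<P>(\<omega> in M. Q m \<omega> \<and> \<not> Null \<omega>) + \<P>(\<omega> in M. Null \<omega> \<and> \<rho> \<le> \<bar>R n \<omega>\<bar>)" if "m < n" for n
    proof -
      have "\<P>(\<omega> in M. Q m \<omega> \<and> \<rho> \<le> \<bar>R n \<omega>\<bar>)
          \<le> prob ({\<omega>\<in>space M. Q m \<omega> \<and> \<not> Null \<omega>} \<union> {\<omega>\<in>space M. Null \<omega> \<and> \<rho> \<le> \<bar>R n \<omega>\<bar>})"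
        by (rule finite_measure_mono) auto
      also have "\<dots> \<le> \<P>(\<omega> in M. Q m \<omega> \<and> \<not> Null \<omega>) + \<P>(\<omega> in M. Null \<omega> \<and> \<rho> \<le> \<bar>R n \<omega>\<bar>)"
        by (rule measure_Un_le) auto
      finally show ?thesis using \<rho>(2)[OF that] by linarith
    qed
    ultimately have "c * \<P>(\<omega> in M. Q m \<omega>) \<le> \<P>(\<omega> in M. Q m \<omega> \<and> \<not> Null \<omega>) + 0"
      by (intro LIMSEQ_le_const) (auto intro!: exI[of _ "Suc m"])
    then show ?thesis by simp
  qed
  \<comment> \<open>A zero limit together with |R m| > \<eta> m forces the noise after m to move by
    at least \<eta> m / 2.\<close>
  have le2: "\<P>(\<omega> in M. Null \<omega> \<and> \<not> Q m \<omega>) \<le> 16 * sqrt (v m)" if "1 \<le> m" for m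
  proof -
    have \<eta>: "0 < \<eta> m" "(\<eta> m)^2 = sqrt (v m)" using v_pos[of m] by (auto simp: \<eta>_def)
    have "\<P>(\<omega> in M. Null \<omega> \<and> \<not> Q m \<omega>)
        \<le> \<P>(\<omega> in M. \<exists>j\<ge>m. \<eta> m / 2 \<le> \<bar>transform (\<lambda>k _. w k) m j \<omega>\<bar>)"
    proof (rule finite_measure_mono)
      show "{\<omega>\<in>space M. Null \<omega> \<and> \<not> Q m \<omega>}
          \<subseteq> {\<omega>\<in>space M. \<exists>j\<ge>m. \<eta> m / 2 \<le> \<bar>transform (\<lambda>k _. w k) m j \<omega>\<bar>}"
      proof safe
        fix \<omega> assume "Null \<omega>" "\<not> Q m \<omega>"
        then have "(\<lambda>n. \<bar>R n \<omega>\<bar>) \<longlonglongrightarrow> 0" using Null_iff tendsto_rabs_zero by blast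
        then have "eventually (\<lambda>j. \<bar>R j \<omega>\<bar> < \<eta> m / 2 \<and> m \<le> j) sequentially"
          using \<eta>(1) by (intro eventually_conj order_tendstoD(2) eventually_ge_at_top) auto
        then obtain j where j: "\<bar>R j \<omega>\<bar> < \<eta> m / 2" "m \<le> j" by (auto simp: eventually_sequentially)
        have "R j \<omega> = R m \<omega> + transform (\<lambda>k _. w k) m j \<omega>"
          unfolding R_def w_def using T_over_growth_eq[OF _ that j(2), of \<omega>] assms by simp
        then have "\<eta> m / 2 \<le> \<bar>transform (\<lambda>k _. w k) m j \<omega>\<bar>"
          using j(1) \<open>\<not> Q m \<omega>\<close> unfolding Q_def by linarith
        with j(2) show "\<exists>j\<ge>m. \<eta> m / 2 \<le> \<bar>transform (\<lambda>k _. w k) m j \<omega>\<bar>" by blast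
      qed
    qed measurable
    also have "\<dots> \<le> 4 * v m / (\<eta> m / 2)^2"
      unfolding v_def using \<eta>(1) by (intro transform_tail_maximal_inequality that w) simp
    also have "\<dots> = 16 * (v m / sqrt (v m))" by (simp add: power_divide \<eta>(2))
    also have "\<dots> = 16 * sqrt (v m)" using v_pos[of m] by (simp add: real_div_sqrt)
    finally show ?thesis .
  qed
  have "\<P>(\<omega> in M. Null \<omega>) \<le> \<P>(\<omega> in M. Q m \<omega> \<and> \<not> Null \<omega>) / c + 16 * sqrt (v m)" if "1 \<le> m" for m
  proof -
    have "\<P>(\<omega> in M. Null \<omega>) \<le> prob ({\<omega>\<in>space M. Q m \<omega>} \<union> {\<omega>\<in>space M. Null \<omega> \<and> \<not> Q m \<omega>})"
      by (rule finite_measure_mono) auto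
    also have "\<dots> \<le> \<P>(\<omega> in M. Q m \<omega>) + \<P>(\<omega> in M. Null \<omega> \<and> \<not> Q m \<omega>)"
      by (rule measure_Un_le) auto
    also have "\<P>(\<omega> in M. Q m \<omega>) \<le> \<P>(\<omega> in M. Q m \<omega> \<and> \<not> Null \<omega>) / c"
      using le1[OF that] \<open>0 < c\<close> by (simp add: pos_le_divide_eq mult.commute)
    finally show ?thesis using le2[OF that] by simp
  qed
  moreover have "(\<lambda>m. \<P>(\<omega> in M. Q m \<omega> \<and> \<not> Null \<omega>) / c + 16 * sqrt (v m)) \<longlonglongrightarrow> 0 / c + 16 * sqrt 0"
    using \<open>0 < c\<close> by (intro tendsto_intros lim1 v_lim) auto
  ultimately have "\<P>(\<omega> in M. Null \<omega>) \<le> 0 / c + 16 * sqrt 0"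
    by (intro LIMSEQ_le_const) auto
  then have "\<P>(\<omega> in M. Null \<omega>) = 0" by (simp add: order_antisym)
  then have "AE \<omega> in M. \<not> Null \<omega>"
    by (subst AE_iff_measurable[OF _ refl]) (simp_all add: emeasure_eq_measure)
  then show ?thesis unfolding Null_iff R_def .
qed

text \<open>The noise variance degenerates here. Instead, the second moment of T k is k^2 while |T
  k| \<le> k, so |T k| = k almost surely, and the normalising product is k.\<close>

lemma T_over_growth_limit_nonzero_one:
  assumes "\<alpha> = 1"
  shows "AE \<omega> in M. \<not> (\<lambda>n. T n \<omega> / growth \<alpha> n) \<longlonglongrightarrow> 0"
proof -
  have int: "integrable M (\<lambda>\<omega>. (T k \<omega>)^2)" for k
    by (intro determined_integrable[of k] adapted_intros determined_T) simp
  have ET: "expectation (\<lambda>\<omega>. (T k \<omega>)^2) = real k^2" if "1 \<le> k" for k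
    using that
  proof (induction k rule: dec_induct)
    case base
    have "(T 1 \<omega>)^2 = 1" for \<omega> using step_values[of 1 \<omega>] by (auto simp: T_def)
    then show ?case by (simp add: prob_space)
  next
    case (step k)
    then have "expectation (\<lambda>\<omega>. (T (Suc k) \<omega>)^2) = (1 + 2 * 1 / k) * real k^2 + 1"
      using expectation_mult_T_power2[of k "\<lambda>_. 1"] assms by (simp add: determined_by_const prob_space)
    also have "\<dots> = real (Suc k)^2" using step by (simp add: power2_eq_square field_simps)
    finally show ?case .
  qed
  have T_sq: "(T k \<omega>)^2 \<le> real k^2" for k \<omega> using power_mono[OF abs_T_le[of k \<omega>], of 2] by simp
  have "AE \<omega> in M. (T k \<omega>)^2 = real k^2" if "1 \<le> k" for k
  proof -
    have "expectation (\<lambda>\<omega>. real k^2 - (T k \<omega>)^2) = 0" using ET[OF that] int by (simp add: prob_space)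
    then have "AE \<omega> in M. real k^2 - (T k \<omega>)^2 = 0"
      using int T_sq by (subst (asm) integral_nonneg_eq_0_iff_AE) auto
    then show ?thesis by eventually_elim simp
  qed
  then have "AE \<omega> in M. \<forall>k\<ge>1. (T k \<omega>)^2 = real k^2"
    by (intro AE_all_countable[THEN iffD2] allI) (auto intro: AE_I2)
  then show ?thesis
  proof eventually_elim
    case (elim \<omega>)
    have "\<bar>T k \<omega> / growth \<alpha> k\<bar> = 1" if "1 \<le> k" for k
    proof -
      have "\<bar>T k \<omega>\<bar> = real k" using elim that by (metis abs_of_nat power2_eq_iff abs_minus_cancel)
      then show ?thesis using that assms growth_one[OF that] by simp
    qed
    then have "eventually (\<lambda>k. \<bar>T k \<omega> / growth \<alpha> k\<bar> = 1) sequentially"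
      by (auto simp: eventually_sequentially)
    then have one: "(\<lambda>k. \<bar>T k \<omega> / growth \<alpha> k\<bar>) \<longlonglongrightarrow> 1" by (rule tendsto_eventually)
    show ?case
    proof
      assume "(\<lambda>n. T n \<omega> / growth \<alpha> n) \<longlonglongrightarrow> 0"
      then have "(\<lambda>n. \<bar>T n \<omega> / growth \<alpha> n\<bar>) \<longlonglongrightarrow> 0" by (rule tendsto_rabs_zero)
      from LIMSEQ_unique[OF one this] show False by simp
    qed
  qed
qed

lemma poly_sum_diverges:
  assumes "1/2 < \<alpha>" "0 < \<gamma>" "\<gamma> \<le> \<alpha>"
  shows "AE \<omega> in M. filterlim (\<lambda>n. erw_poly_sum Y \<gamma> n \<omega>) at_bot sequentially
    \<or> filterlim (\<lambda>n. erw_poly_sum Y \<gamma> n \<omega>) at_top sequentially"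
proof -
  have "AE \<omega> in M. \<not> (\<lambda>n. T n \<omega> / growth \<alpha> n) \<longlonglongrightarrow> 0"
    using T_over_growth_limit_nonzero_less_one T_over_growth_limit_nonzero_one assms(1) alpha_bounds(2)
    by (cases "\<alpha> = 1") auto
  then show ?thesis using T_over_growth_convergent[OF assms(1)]
  proof eventually_elim
    case (elim \<omega>)
    then obtain L where L: "(\<lambda>n. T n \<omega> / growth \<alpha> n) \<longlonglongrightarrow> L" "L \<noteq> 0"
      by (auto simp: convergent_def)
    show ?case
    proof (cases "0 < L")
      case True
      with L(1) show ?thesis
        using erw_poly_sum_at_top[of \<gamma> \<alpha> Y \<omega> L] assms alpha_bounds by (simp add: T_def)
    next
      case False
      have "(\<lambda>n. (\<Sum>j=1..n. - Y j \<omega>) / growth \<alpha> n) \<longlonglongrightarrow> - L"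
        using tendsto_minus[OF L(1)] by (simp add: T_def sum_negf)
      then have "filterlim (\<lambda>n. erw_poly_sum (\<lambda>k \<omega>. - Y k \<omega>) \<gamma> n \<omega>) at_top sequentially"
        using erw_poly_sum_at_top[of \<gamma> \<alpha> "\<lambda>k \<omega>. - Y k \<omega>" \<omega> "- L"] assms alpha_bounds False L(2) by simp
      then show ?thesis
        by (simp add: erw_poly_sum_def sum_negf filterlim_uminus_at_bot)
    qed
  qed
qed

end

section \<open>The elephant random walk as a step process\<close>

text \<open>Decodes the real-valued memory source. For n \<ge> 1 the default 1 lies in {1..n}, so
  \<open>walk\<close> only ever recalls an earlier step, as its termination requires.\<close>

definition recalled :: "nat \<Rightarrow> real \<Rightarrow> nat" where
  "recalled n u = (if nat \<lfloor>u\<rfloor> \<in> {1..n} then nat \<lfloor>u\<rfloor> else 1)"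

lemma recalled_range: "1 \<le> n \<Longrightarrow> recalled n u \<in> {1..n}"
  by (auto simp: recalled_def)

lemma recalled_of_nat: "j \<in> {1..n} \<Longrightarrow> recalled n (real j) = j"
  by (simp add: recalled_def)

lemma recalled_measurable [measurable]: "recalled n \<in> measurable borel (count_space UNIV)"
proof -
  have "(\<lambda>u. nat \<lfloor>u\<rfloor>) \<in> measurable (borel :: real measure) (count_space UNIV)" by measurable
  from measurable_compose[OF this, of "\<lambda>k. if k \<in> {1..n} then k else 1"] show ?thesis
    by (simp add: recalled_def[abs_def])
qed

text \<open>The steps as a function of the values of the sources. Memory values outside \<open>{1..n}\<close>, which have
  probability zero, are redirected to \<open>1\<close>: a version of \<open>X\<close> is obtained that is measurable and
  takes only the values \<open>1\<close> and \<open>-1\<close>, neither of which need hold for \<open>X\<close>.\<close>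

function walk :: "(erw_source \<Rightarrow> real) \<Rightarrow> nat \<Rightarrow> real" where
  "walk f 0 = 1"
| "walk f (Suc 0) = (if f First = -1 then -1 else 1)"
| "walk f (Suc (Suc n)) = (if f (Coin (Suc n)) = 1 then 1 else -1)
     * walk f (recalled (Suc n) (f (Memory (Suc n))))"
  by pat_completeness auto
termination
  by (relation "Wellfounded.measure snd") (auto simp: recalled_def)

lemma walk_values: "walk f n = 1 \<or> walk f n = -1"
  by (induction f n rule: walk.induct) auto

text \<open>Step k + 1 uses the sources with index k, so the first n steps use indices below n, and
  those with index n are fresh for step n + 1.\<close>

definition sources_before :: "nat \<Rightarrow> erw_source set" where
  "sources_before n = {First} \<union> Memory ` {1..<n} \<union> Coin ` {1..<n}"

lemma sources_before_mono: "m \<le> n \<Longrightarrow> sources_before m \<subseteq> sources_before n"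
  by (auto simp: sources_before_def)

text \<open>The random index is resolved by summing over its possible values: each summand is a
  function of earlier sources times a function of the two fresh ones, ready for
  independence.\<close>

lemma walk_Suc:
  assumes "1 \<le> n"
  shows "walk f (Suc n) = (\<Sum>j=1..n. walk f j *
    (of_bool (recalled n (f (Memory n)) = j) * (if f (Coin n) = 1 then 1 else -1)))"
proof -
  obtain k where n: "n = Suc k" using assms by (cases n) auto
  let ?r = "recalled n (f (Memory n))"
  have "(\<Sum>j=1..n. walk f j * (of_bool (?r = j) * (if f (Coin n) = 1 then 1 else -1)))
      = (\<Sum>j=1..n. if ?r = j then walk f j * (if f (Coin n) = 1 then 1 else -1) else 0)"
    by (intro sum.cong) auto
  also have "\<dots> = walk f ?r * (if f (Coin n) = 1 then 1 else -1)"
    using recalled_range[OF assms] by (subst sum.delta') auto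
  finally show ?thesis using n by simp
qed

lemma walk_cong: "(\<And>s. s \<in> sources_before n \<Longrightarrow> f s = g s) \<Longrightarrow> walk f n = walk g n"
proof (induction n rule: less_induct)
  case (less n)
  consider "n = 0" | "n = Suc 0" | k where "n = Suc k" "1 \<le> k"
    by (metis One_nat_def Suc_leI not0_implies_Suc neq0_conv)
  then show ?case
  proof cases
    case (3 k)
    have "walk f j = walk g j" if "j \<in> {1..k}" for j
      using less.IH[of j] less.prems sources_before_mono[of j n] that 3 by auto
    moreover have "f (Memory k) = g (Memory k)" "f (Coin k) = g (Coin k)"
      using less.prems 3 by (auto simp: sources_before_def)
    ultimately show ?thesis unfolding 3(1) walk_Suc[OF 3(2)] by (intro sum.cong) auto
  qed (use less.prems in \<open>auto simp: sources_before_def\<close>)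
qed

lemma walk_measurable:
  assumes "\<And>s. s \<in> sources_before n \<Longrightarrow> (\<lambda>x. g x s) \<in> borel_measurable N"
  shows "(\<lambda>x. walk (g x) n) \<in> borel_measurable N"
  using assms
proof (induction n rule: less_induct)
  case (less n)
  consider "n = 0" | "n = Suc 0" | k where "n = Suc k" "1 \<le> k"
    by (metis One_nat_def Suc_leI not0_implies_Suc neq0_conv)
  then show ?case
  proof cases
    case 2
    have [measurable]: "(\<lambda>x. g x First) \<in> borel_measurable N"
      using less.prems by (simp add: sources_before_def)
    show ?thesis unfolding 2 walk.simps by measurable
  next
    case (3 k)
    have [measurable]: "(\<lambda>x. g x (Memory k)) \<in> borel_measurable N" "(\<lambda>x. g x (Coin k)) \<in> borel_measurable N"
      using less.prems 3 by (auto simp: sources_before_def)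
    have "(\<lambda>x. walk (g x) j) \<in> borel_measurable N" if "j \<in> {1..k}" for j
      using less.IH[of j] less.prems sources_before_mono[of j n] that 3 by auto
    then show ?thesis
      unfolding 3(1) walk_Suc[OF 3(2)]
      by (intro borel_measurable_sum borel_measurable_times; measurable)
  qed simp
qed

section \<open>Independence of the sources and the regression identity\<close>

context elephant_random_walk begin

definition source :: "erw_source \<Rightarrow> 'a \<Rightarrow> real" where
  "source s = (case s of First \<Rightarrow> X 1 | Memory n \<Rightarrow> (\<lambda>\<omega>. real (U n \<omega>)) | Coin n \<Rightarrow> (\<lambda>\<omega>. of_bool (C n \<omega>)))"

definition Y :: "nat \<Rightarrow> 'a \<Rightarrow> real" where
  "Y n \<omega> = walk (\<lambda>s. source s \<omega>) n"

abbreviation "all_sources \<equiv> {First} \<union> Memory ` {1..} \<union> Coin ` {1..}"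

lemma indep_source: "indep_vars (\<lambda>_. borel) source all_sources"
  using indep_sources unfolding source_def .

lemma source_measurable: "s \<in> all_sources \<Longrightarrow> source s \<in> borel_measurable M"
  using indep_source unfolding indep_vars_def by blast

lemma Y_measurable: "Y n \<in> borel_measurable M"
  unfolding Y_def[abs_def]
  by (rule walk_measurable) (auto simp: sources_before_def intro!: source_measurable)

lemma source_indep_expectation:
  assumes "A \<inter> B = {}" "A \<subseteq> all_sources" "B \<subseteq> all_sources"
    and G: "G \<in> borel_measurable (PiM A (\<lambda>_. borel))" and H: "H \<in> borel_measurable (PiM B (\<lambda>_. borel))"
    and int: "integrable M (\<lambda>\<omega>. G (\<lambda>s\<in>A. source s \<omega>))" "integrable M (\<lambda>\<omega>. H (\<lambda>s\<in>B. source s \<omega>))"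
  shows "expectation (\<lambda>\<omega>. G (\<lambda>s\<in>A. source s \<omega>) * H (\<lambda>s\<in>B. source s \<omega>) :: real)
    = expectation (\<lambda>\<omega>. G (\<lambda>s\<in>A. source s \<omega>)) * expectation (\<lambda>\<omega>. H (\<lambda>s\<in>B. source s \<omega>))"
proof -
  have "indep_var borel (G \<circ> (\<lambda>\<omega>. \<lambda>s\<in>A. source s \<omega>)) borel (H \<circ> (\<lambda>\<omega>. \<lambda>s\<in>B. source s \<omega>))"
    by (rule indep_var_compose[OF indep_var_restrict[OF indep_source assms(1-3)] G H])
  then show ?thesis using int by (intro indep_var_lebesgue_integral) (simp_all add: comp_def)
qed

lemma U_event: "1 \<le> n \<Longrightarrow> {\<omega>\<in>space M. U n \<omega> = k} \<in> events"
proof -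
  assume "1 \<le> n"
  then have [measurable]: "source (Memory n) \<in> borel_measurable M" by (intro source_measurable) auto
  have "{\<omega>\<in>space M. source (Memory n) \<omega> = real k} \<in> events" by measurable
  then show ?thesis by (simp add: source_def)
qed

lemma AE_U_range: "1 \<le> n \<Longrightarrow> AE \<omega> in M. U n \<omega> \<in> {1..n}"
proof -
  assume n: "1 \<le> n"
  have "prob (\<Union>k\<in>{1..n}. {\<omega>\<in>space M. U n \<omega> = k}) = (\<Sum>k\<in>{1..n}. prob {\<omega>\<in>space M. U n \<omega> = k})"
    using U_event[OF n] by (intro finite_measure_finite_Union) (auto simp: disjoint_family_on_def)
  also have "\<dots> = (\<Sum>k\<in>{1..n}. 1 / real n)" using memory_uniform by (intro sum.cong) auto
  also have "\<dots> = 1" using n by simp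
  finally have "AE \<omega> in M. \<omega> \<in> (\<Union>k\<in>{1..n}. {\<omega>\<in>space M. U n \<omega> = k})"
    using U_event[OF n] by (subst (asm) prob_eq_1) auto
  then show ?thesis by eventually_elim auto
qed

lemma AE_first_step: "AE \<omega> in M. X 1 \<omega> = 1 \<or> X 1 \<omega> = -1"
proof -
  have [measurable]: "X 1 \<in> borel_measurable M" using source_measurable[of First] by (simp add: source_def)
  have ev: "{\<omega>\<in>space M. X 1 \<omega> = 1} \<in> events" "{\<omega>\<in>space M. X 1 \<omega> = -1} \<in> events" by measurable
  have "prob ({\<omega>\<in>space M. X 1 \<omega> = 1} \<union> {\<omega>\<in>space M. X 1 \<omega> = -1}) = 1"
    using first_step_pos first_step_neg by (subst finite_measure_Union[OF ev]) auto
  then have "AE \<omega> in M. \<omega> \<in> {\<omega>\<in>space M. X 1 \<omega> = 1} \<union> {\<omega>\<in>space M. X 1 \<omega> = -1}"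
    using ev by (subst (asm) prob_eq_1) auto
  then show ?thesis by eventually_elim auto
qed

text \<open>The two can differ only where a memory value leaves its range or the first step is
  neither 1 nor -1, which has probability zero.\<close>

lemma AE_Y_eq_X: "AE \<omega> in M. \<forall>k\<ge>1. Y k \<omega> = X k \<omega>"
proof -
  have "AE \<omega> in M. \<forall>n. 1 \<le> n \<longrightarrow> U n \<omega> \<in> {1..n}"
    using AE_U_range by (intro AE_all_countable[THEN iffD2] allI) (auto intro: AE_I2)
  then show ?thesis using AE_first_step AE_space
  proof eventually_elim
    case (elim \<omega>)
    have "Y k \<omega> = X k \<omega>" if "1 \<le> k" for k
      using that
    proof (induction k rule: less_induct)
      case (less k)
      show ?case
      proof (cases "k = 1")
        case True
        then show ?thesis using elim(2) by (auto simp: Y_def source_def)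
      next
        case False
        then obtain n where n: "k = Suc (Suc n)" using less.prems by (metis One_nat_def Suc_le_D le_SucE Suc_le_mono not0_implies_Suc)
        have U: "U (Suc n) \<omega> \<in> {1..Suc n}" using elim(1) by simp
        then have "Y (U (Suc n) \<omega>) \<omega> = X (U (Suc n) \<omega>) \<omega>" using less.IH n by simp
        then show ?thesis
          using step[of "Suc n" \<omega>] elim(3) U unfolding n
          by (simp add: Y_def source_def recalled_of_nat del: atLeastAtMost_iff)
      qed
    qed
    then show ?case by blast
  qed
qed

lemma p_bounds: "0 \<le> p" "p \<le> 1"
  using coin[of 1] by (simp_all flip: coin[of 1])

text \<open>The memory hits j with probability 1 / n, and the independent sign has mean p - (1 -
  p).\<close>

lemma expectation_recall:
  assumes "j \<in> {1..n}"
  shows "expectation (\<lambda>\<omega>. of_bool (recalled n (source (Memory n) \<omega>) = j) * (if source (Coin n) \<omega> = 1 then 1 else -1))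
    = (2 * p - 1) / n"
proof -
  have n: "1 \<le> n" using assms by simp
  have [measurable]: "source (Memory n) \<in> borel_measurable M" "source (Coin n) \<in> borel_measurable M"
    using n by (auto intro!: source_measurable)
  define G :: "(erw_source \<Rightarrow> real) \<Rightarrow> real" where "G = (\<lambda>f. of_bool (recalled n (f (Memory n)) = j))"
  define H :: "(erw_source \<Rightarrow> real) \<Rightarrow> real" where "H = (\<lambda>f. if f (Coin n) = 1 then 1 else -1)"
  have "expectation (\<lambda>\<omega>. G (\<lambda>s\<in>{Memory n}. source s \<omega>) * H (\<lambda>s\<in>{Coin n}. source s \<omega>))
      = expectation (\<lambda>\<omega>. G (\<lambda>s\<in>{Memory n}. source s \<omega>)) * expectation (\<lambda>\<omega>. H (\<lambda>s\<in>{Coin n}. source s \<omega>))"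
  proof (rule source_indep_expectation)
    show "G \<in> borel_measurable (PiM {Memory n} (\<lambda>_. borel))" unfolding G_def by measurable
    show "H \<in> borel_measurable (PiM {Coin n} (\<lambda>_. borel))" unfolding H_def by measurable
    show "integrable M (\<lambda>\<omega>. G (\<lambda>s\<in>{Memory n}. source s \<omega>))"
      by (rule integrable_const_bound[where B = 1]) (auto simp: G_def)
    show "integrable M (\<lambda>\<omega>. H (\<lambda>s\<in>{Coin n}. source s \<omega>))"
      by (rule integrable_const_bound[where B = 1]) (auto simp: H_def)
  qed (use n in auto)
  moreover have "expectation (\<lambda>\<omega>. G (\<lambda>s\<in>{Memory n}. source s \<omega>)) = 1 / n"
  proof -
    have "expectation (\<lambda>\<omega>. G (\<lambda>s\<in>{Memory n}. source s \<omega>)) = expectation (\<lambda>\<omega>. of_bool (U n \<omega> = j))"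
    proof (rule integral_cong_AE)
      show "AE \<omega> in M. G (\<lambda>s\<in>{Memory n}. source s \<omega>) = of_bool (U n \<omega> = j)"
        using AE_U_range[OF n] by eventually_elim (simp add: G_def source_def recalled_of_nat)
      have "(\<lambda>\<omega>. of_bool (U n \<omega> = j) :: real) = (\<lambda>\<omega>. of_bool (source (Memory n) \<omega> = real j))"
        by (simp add: source_def)
      then show "(\<lambda>\<omega>. of_bool (U n \<omega> = j) :: real) \<in> borel_measurable M" by simp
    qed (simp add: G_def)
    also have "\<dots> = 1 / n"
      using expectation_of_bool[OF U_event[OF n, of j]] memory_uniform[of j n] assms by simp
    finally show ?thesis .
  qed
  moreover have "expectation (\<lambda>\<omega>. H (\<lambda>s\<in>{Coin n}. source s \<omega>)) = 2 * p - 1"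
  proof -
    have int: "integrable M (source (Coin n))"
      by (rule integrable_const_bound[where B = 1], simp add: source_def, measurable)
    have "{\<omega>\<in>space M. source (Coin n) \<omega> = 1} \<in> events" by measurable
    then have "{\<omega>\<in>space M. C n \<omega>} \<in> events" by (simp add: source_def)
    from expectation_of_bool[OF this] have "expectation (source (Coin n)) = p"
      using coin[OF n] by (simp add: source_def)
    moreover have "H (\<lambda>s\<in>{Coin n}. source s \<omega>) = 2 * source (Coin n) \<omega> - 1" for \<omega>
      by (simp add: H_def source_def)
    ultimately show ?thesis using int by (simp add: prob_space)
  qed
  ultimately show ?thesis by (simp add: G_def H_def)
qed

text \<open>For the regression, Z times step n + 1 is a sum over j of Z times step j, a function of
  the sources before n, times a factor in the two sources of index n. The latter is independent of
  the former and has the same mean (2 p - 1) / n for every j, so the sum of the steps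
  reappears.\<close>

sublocale steps: step_process M "2 * p - 1" Y
proof
  show "-1 \<le> 2 * p - 1" "2 * p - 1 \<le> 1" using p_bounds by simp_all
  show "Y k \<in> borel_measurable M" for k by (rule Y_measurable)
  show "Y k \<omega> = 1 \<or> Y k \<omega> = -1" for k \<omega> unfolding Y_def by (rule walk_values)
  fix n :: nat and Z :: "'a \<Rightarrow> real"
  assume n: "1 \<le> n" and "determined_by Y n Z"
  then obtain \<phi> where \<phi>: "\<And>\<omega>. Z \<omega> = \<phi> (map (\<lambda>k. Y k \<omega>) [1..<Suc n])"
    using determined_by_factor by blast
  let ?A = "sources_before n" and ?B = "{Memory n, Coin n}"
  define G where "G = (\<lambda>j f. \<phi> (map (\<lambda>k. walk f k) [1..<Suc n]) * walk f j)"
  define H :: "nat \<Rightarrow> (erw_source \<Rightarrow> real) \<Rightarrow> real"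
    where "H = (\<lambda>j f. of_bool (recalled n (f (Memory n)) = j) * (if f (Coin n) = 1 then 1 else -1))"
  have G_meas: "G j \<in> borel_measurable (PiM ?A (\<lambda>_. borel))" if "j \<in> {1..n}" for j
  proof -
    have w: "(\<lambda>f. walk f k) \<in> borel_measurable (PiM ?A (\<lambda>_. borel))" if "k \<le> n" for k
      using sources_before_mono[OF that] by (intro walk_measurable measurable_component_singleton) auto
    have "(\<lambda>f. \<phi> (map (\<lambda>k. walk f k) [1..<Suc n])) \<in> measurable (PiM ?A (\<lambda>_. borel)) (count_space UNIV)"
      by (rule history_measurable) (use w walk_values in auto)
    from measurable_compose[OF this, of id borel]
    have "(\<lambda>f. \<phi> (map (\<lambda>k. walk f k) [1..<Suc n])) \<in> borel_measurable (PiM ?A (\<lambda>_. borel))" by simp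
    then show ?thesis unfolding G_def using w[of j] that by (intro borel_measurable_times) auto
  qed
  have G_eq: "G j (\<lambda>s\<in>?A. source s \<omega>) = Z \<omega> * Y j \<omega>" if "j \<in> {1..n}" for j \<omega>
  proof -
    have "walk (\<lambda>s\<in>?A. source s \<omega>) k = Y k \<omega>" if "k \<le> n" for k
      unfolding Y_def using sources_before_mono[OF that] by (intro walk_cong) auto
    then have "map (\<lambda>k. walk (\<lambda>s\<in>?A. source s \<omega>) k) [1..<Suc n] = map (\<lambda>k. Y k \<omega>) [1..<Suc n]"
      "walk (\<lambda>s\<in>?A. source s \<omega>) j = Y j \<omega>"
      using that by (auto simp del: upt_Suc)
    then show ?thesis unfolding G_def \<phi> by presburger
  qed
  have H_eq: "H j (\<lambda>s\<in>?B. source s \<omega>) = of_bool (recalled n (source (Memory n) \<omega>) = j)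
      * (if source (Coin n) \<omega> = 1 then 1 else -1)" for j \<omega>
    by (simp add: H_def)
  have [measurable]: "source (Memory n) \<in> borel_measurable M" "source (Coin n) \<in> borel_measurable M"
    using n by (auto intro!: source_measurable)
  have H_int: "integrable M (\<lambda>\<omega>. H j (\<lambda>s\<in>?B. source s \<omega>))" for j
    unfolding H_eq by (rule integrable_const_bound[where B = 1]) auto
  \<comment> \<open>\<open>Z\<close> is a function of one of finitely many sign lists, hence
    bounded.\<close>
  obtain K where K: "\<And>\<omega>. \<bar>Z \<omega>\<bar> \<le> K"
  proof
    fix \<omega>
    let ?L = "{l. set l \<subseteq> {1, -1::real} \<and> length l = n}"
    have "finite ?L" by (rule finite_lists_length_eq) simp
    moreover have "map (\<lambda>k. Y k \<omega>) [1..<Suc n] \<in> ?L"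
      using walk_values by (auto simp: Y_def simp del: upt_Suc)
    ultimately show "\<bar>Z \<omega>\<bar> \<le> Max ((\<lambda>l. \<bar>\<phi> l\<bar>) ` ?L)"
      unfolding \<phi> by (intro Max_ge finite_imageI imageI)
  qed
  have Z_meas: "Z \<in> borel_measurable M"
  proof -
    have "(\<lambda>\<omega>. \<phi> (map (\<lambda>k. Y k \<omega>) [1..<Suc n])) \<in> measurable M (count_space UNIV)"
      by (rule history_measurable[OF Y_measurable]) (simp add: Y_def walk_values)
    moreover have "Z = (\<lambda>\<omega>. \<phi> (map (\<lambda>k. Y k \<omega>) [1..<Suc n]))" by (rule ext) (rule \<phi>)
    ultimately show ?thesis using measurable_compose[of Z M "count_space UNIV" id borel] by simp
  qed
  have absY: "\<bar>Y j \<omega>\<bar> = 1" for j \<omega> using walk_values[of "\<lambda>s. source s \<omega>" j] by (auto simp: Y_def)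
  have ZY_int: "integrable M (\<lambda>\<omega>. Z \<omega> * Y j \<omega>)" for j
    by (rule integrable_const_bound[where B = K])
       (use K Z_meas Y_measurable in \<open>auto simp: abs_mult absY\<close>)
  have prod: "expectation (\<lambda>\<omega>. G j (\<lambda>s\<in>?A. source s \<omega>) * H j (\<lambda>s\<in>?B. source s \<omega>))
      = expectation (\<lambda>\<omega>. Z \<omega> * Y j \<omega>) * ((2 * p - 1) / n)" if j: "j \<in> {1..n}" for j
  proof -
    have "expectation (\<lambda>\<omega>. G j (\<lambda>s\<in>?A. source s \<omega>) * H j (\<lambda>s\<in>?B. source s \<omega>))
      = expectation (\<lambda>\<omega>. G j (\<lambda>s\<in>?A. source s \<omega>)) * expectation (\<lambda>\<omega>. H j (\<lambda>s\<in>?B. source s \<omega>))"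
    proof (rule source_indep_expectation[OF _ _ _ G_meas[OF j]])
      show "H j \<in> borel_measurable (PiM ?B (\<lambda>_. borel))" unfolding H_def by measurable
      show "integrable M (\<lambda>\<omega>. G j (\<lambda>s\<in>?A. source s \<omega>))" using ZY_int G_eq[OF j] by simp
      show "integrable M (\<lambda>\<omega>. H j (\<lambda>s\<in>?B. source s \<omega>))" by (rule H_int)
    qed (use n in \<open>auto simp: sources_before_def\<close>)
    then show ?thesis unfolding G_eq[OF j] H_eq expectation_recall[OF j] .
  qed
  have "Z \<omega> * Y (Suc n) \<omega> = (\<Sum>j=1..n. G j (\<lambda>s\<in>?A. source s \<omega>) * H j (\<lambda>s\<in>?B. source s \<omega>))" for \<omega>
  proof -
    have "Z \<omega> * Y (Suc n) \<omega> = (\<Sum>j=1..n. (Z \<omega> * Y j \<omega>) * H j (\<lambda>s\<in>?B. source s \<omega>))"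
      unfolding Y_def[of "Suc n"] walk_Suc[OF n] H_eq by (simp add: sum_distrib_left Y_def mult.assoc)
    then show ?thesis using G_eq by simp
  qed
  then have "expectation (\<lambda>\<omega>. Z \<omega> * Y (Suc n) \<omega>)
      = expectation (\<lambda>\<omega>. \<Sum>j=1..n. G j (\<lambda>s\<in>?A. source s \<omega>) * H j (\<lambda>s\<in>?B. source s \<omega>))"
    by simp
  also have "\<dots> = (\<Sum>j=1..n. expectation (\<lambda>\<omega>. G j (\<lambda>s\<in>?A. source s \<omega>) * H j (\<lambda>s\<in>?B. source s \<omega>)))"
  proof (rule Bochner_Integration.integral_sum)
    fix j assume j: "j \<in> {1..n}"
    show "integrable M (\<lambda>\<omega>. G j (\<lambda>s\<in>?A. source s \<omega>) * H j (\<lambda>s\<in>?B. source s \<omega>))"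
      unfolding G_eq[OF j] H_eq
      by (rule integrable_const_bound[where B = K])
         (use K order_trans[OF abs_ge_zero K] Z_meas Y_measurable in \<open>auto simp: abs_mult absY\<close>)
  qed
  also have "\<dots> = (2 * p - 1) / n * (\<Sum>j=1..n. expectation (\<lambda>\<omega>. Z \<omega> * Y j \<omega>))"
    using prod by (simp add: sum_distrib_left mult.commute)
  also have "(\<Sum>j=1..n. expectation (\<lambda>\<omega>. Z \<omega> * Y j \<omega>)) = expectation (\<lambda>\<omega>. Z \<omega> * (\<Sum>j=1..n. Y j \<omega>))"
    using ZY_int by (simp add: sum_distrib_left)
  finally show "expectation (\<lambda>\<omega>. Z \<omega> * Y (Suc n) \<omega>)
    = (2 * p - 1) / real n * expectation (\<lambda>\<omega>. Z \<omega> * (\<Sum>k=1..n. Y k \<omega>))" .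
qed

lemma AE_erw_poly_sum_eq: "AE \<omega> in M. \<forall>n. erw_poly_sum X \<gamma> n \<omega> = erw_poly_sum Y \<gamma> n \<omega>"
  using AE_Y_eq_X by eventually_elim (auto simp: erw_poly_sum_def intro!: sum.cong)

end

theorem theorem2p1:
  fixes M :: "'a measure" and p q \<alpha> \<gamma> :: real
    and X :: "nat \<Rightarrow> 'a \<Rightarrow> real" and U :: "nat \<Rightarrow> 'a \<Rightarrow> nat" and C :: "nat \<Rightarrow> 'a \<Rightarrow> bool"
    and S :: "nat \<Rightarrow> 'a \<Rightarrow> real"
  assumes "p \<in> {0..1}" and "q \<in> {0..1}"
    and "\<alpha> = 2 * p - 1"
    and "\<gamma> > 0"
    and "elephant_random_walk M p q X U C"
    and "S = erw_poly_sum X \<gamma>"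
  shows
    "(\<alpha> \<in> {-1..1/2} \<longrightarrow>
        (\<gamma> \<in> {0<..1/2} \<and> \<gamma> \<noteq> gamma0 \<alpha> \<longrightarrow>
           (AE \<omega> in M. -\<infinity> = liminf (\<lambda>n. ereal (S n \<omega>)) \<and>
              liminf (\<lambda>n. ereal (S n \<omega>)) < limsup (\<lambda>n. ereal (S n \<omega>)) \<and>
              limsup (\<lambda>n. ereal (S n \<omega>)) = \<infinity>)) \<and>
        (\<gamma> > 1/2 \<longrightarrow> (AE \<omega> in M. convergent (\<lambda>n. S n \<omega>)))) \<and>
     (\<alpha> \<in> {1/2<..1} \<longrightarrow>
        (\<gamma> \<in> {0<..\<alpha>} \<longrightarrow>
           (AE \<omega> in M. filterlim (\<lambda>n. S n \<omega>) at_bot sequentially \<or>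
              filterlim (\<lambda>n. S n \<omega>) at_top sequentially)) \<and>
        (\<gamma> > \<alpha> \<longrightarrow> (AE \<omega> in M. convergent (\<lambda>n. S n \<omega>))))"
proof -
  interpret elephant_random_walk M p q X U C by fact
  note alpha = \<open>\<alpha> = 2 * p - 1\<close> and S = \<open>S = erw_poly_sum X \<gamma>\<close>
  have "AE \<omega> in M. -\<infinity> = liminf (\<lambda>n. ereal (S n \<omega>)) \<and>
      liminf (\<lambda>n. ereal (S n \<omega>)) < limsup (\<lambda>n. ereal (S n \<omega>)) \<and>
      limsup (\<lambda>n. ereal (S n \<omega>)) = \<infinity>"
    if "\<alpha> \<le> 1/2" "\<gamma> \<le> 1/2"
    using AE_erw_poly_sum_eq[of \<gamma>] steps.poly_sum_oscillates[of \<gamma>] that \<open>\<gamma> > 0\<close> alpha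
    unfolding S by (auto elim: eventually_elim2)
  \<comment> \<open>Since max \<alpha> (1/2) is 1/2 in (i) and \<alpha> in (ii), this serves both
    convergence claims.\<close>
  moreover have "AE \<omega> in M. convergent (\<lambda>n. S n \<omega>)" if "1/2 < \<gamma>" "\<alpha> < \<gamma>"
    using AE_erw_poly_sum_eq[of \<gamma>] steps.poly_sum_convergent[of \<gamma>] that alpha
    unfolding S by (auto elim: eventually_elim2)
  moreover have "AE \<omega> in M. filterlim (\<lambda>n. S n \<omega>) at_bot sequentially
      \<or> filterlim (\<lambda>n. S n \<omega>) at_top sequentially" if "1/2 < \<alpha>" "\<gamma> \<le> \<alpha>"
    using AE_erw_poly_sum_eq[of \<gamma>] steps.poly_sum_diverges[of \<gamma>] that \<open>\<gamma> > 0\<close> alpha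
    unfolding S by (auto elim: eventually_elim2)
  ultimately show ?thesis by auto
qed

end
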